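(* Let $n\ge2$ and let $(\mathfrak g,[\cdot,\cdots,\cdot],\alpha)$ be an $n$-ary multiplicative Hom-Nambu-Lie superalgebra over $\mathbb{K}$ with $H^2(\mathfrak g,\mathfrak g)=0$. Then $(\mathfrak g,[\cdot,\cdots,\cdot],\alpha)$ is analytically rigid, i.e. every deformation $f_t$ of $(\mathfrak g,[\cdot,\cdots,\cdot],\alpha)$ is equivalent to the null deformation $f_0=[\cdot,\cdots,\cdot]$.
   Context: All vector spaces are over a fixed field $\mathbb{K}$. For a $\mathbb{Z}_2$-graded vector space $\mathfrak g=\mathfrak g_{\bar 0}\oplus\mathfrak g_{\bar 1}$, $|x|\in\mathbb{Z}_2$ denotes the degree of a homogeneous element $x$; whenever $|x|$ appears, $x$ is assumed homogeneous. A (multi)linear map has degree $|f|$ if $|f(x_1,\cdots,x_m)|=|f|+|x_1|+\cdots+|x_m|$; it is even if $|f|=\bar0$. An $n$-ary multiplicative Hom-Nambu-Lie superalgebra is a triple $(\mathfrak g,[\cdot,\cdots,\cdot],\alpha)$ consisting of a $\mathbb{Z}_2$-graded vector space $\mathfrak g$, an $n$-linear map $[\cdot,\cdots,\cdot]:\mathfrak g\times\cdots\times\mathfrak g\to\mathfrak g$ and an even linear map $\alpha:\mathfrak g\to\mathfrak g$ such that, for all homogeneous elements: (1) $|[x_1,\cdots,x_n]|=|x_1|+\cdots+|x_n|$; (2) $[x_1,\cdots,x_i,x_{i+1},\cdots,x_n]=-(-1)^{|x_i||x_{i+1}|}[x_1,\cdots,x_{i+1},x_i,\cdots,x_n]$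 for $1\le i\le n-1$; (3) $[\alpha(x_1),\cdots,\alpha(x_{n-1}),[y_1,\cdots,y_n]]=\sum_{i=1}^n(-1)^{(|x_1|+\cdots+|x_{n-1}|)(|y_1|+\cdots+|y_{i-1}|)}[\alpha(y_1),\cdots,\alpha(y_{i-1}),[x_1,\cdots,x_{n-1},y_i],\alpha(y_{i+1}),\cdots,\alpha(y_n)]$; (4) $\alpha[x_1,\cdots,x_n]=[\alpha(x_1),\cdots,\alpha(x_n)]$. Deformations. $\mathfrak g[[t]]$ is the $\mathbb{K}[[t]]$-module of formal power series with coefficients in $\mathfrak g$, and $\alpha$ is extended $\mathbb{K}[[t]]$-linearly. A deformation of $(\mathfrak g,[\cdot,\cdots,\cdot],\alpha)$ is a $\mathbb{K}[[t]]$-$n$-linear map $f_t=\sum_{p\ge0}f_pt^p:\mathfrak g[[t]]\times\cdots\times\mathfrak g[[t]]\to\mathfrak g[[t]]$, where each $f_p:\mathfrak g\times\cdots\times\mathfrak g\to\mathfrak g$ is $\mathbb{K}$-$n$-linear (extended $\mathbb{K}[[t]]$-linearly) and $f_0=[\cdot,\cdots,\cdot]$, such that $(\mathfrak g[[t]],f_t,\alpha)$ is an $n$-ary multiplicative Hom-Nambu-Lie superalgebra (i.e. satisfies (1)–(4) with $f_t$ as bracket). The null deformation is the one with $f_1=f_2=\cdots=0$, i.e. $f_t=f_0$. Two deformations $f_t,f'_t$ are equivalent ($f_t\sim f'_t$) if there is an isomorphism $\Phi_t=\sum_{i\ge0}\varphi_it^i:(\mathfrak g[[t]],f_t,\alpha)\to(\mathfrak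 g[[t]],f'_t,\alpha)$, with $\varphi_i:\mathfrak g\to\mathfrak g$ even linear maps, $\varphi_0=\mathrm{id}_{\mathfrak g}$, $\varphi_i\circ\alpha=\alpha\circ\varphi_i$ for all $i$, and $\Phi_t\circ f_t(x_1,\cdots,x_n)=f'_t(\Phi_t(x_1),\cdots,\Phi_t(x_n))$. Cohomology. $C^1(\mathfrak g,\mathfrak g)$ is the $\mathbb{Z}_2$-graded space of linear maps $\varphi:\mathfrak g\to\mathfrak g$ with $\varphi\circ\alpha=\alpha\circ\varphi$. $C^2(\mathfrak g,\mathfrak g)$ is the $\mathbb{Z}_2$-graded space of $n$-linear maps $f:\mathfrak g\times\cdots\times\mathfrak g\to\mathfrak g$ that are super-skew-symmetric (i.e. satisfy the identity (2) with $f$ in place of the bracket) and satisfy $\alpha(f(x_1,\cdots,x_n))=f(\alpha(x_1),\cdots,\alpha(x_n))$. For homogeneous $\varphi\in C^1(\mathfrak g,\mathfrak g)$, $$\delta^1\varphi(x_1,\cdots,x_n)=-\varphi[x_1,\cdots,x_n]+\sum_{i=1}^n(-1)^{|\varphi|(|x_1|+\cdots+|x_{i-1}|)}[x_1,\cdots,\varphi(x_i),\cdots,x_n]\in C^2(\mathfrak g,\mathfrak g).$$ For homogeneous $f\in C^2(\mathfrak g,\mathfrak g)$, writing $|X|=|x_1|+\cdots+|x_{n-1}|$, $$\begin{aligned}\delta^2f(x_1,\cdots,x_{n-1},y_1,\cdots,y_n)=&\ f(\alpha(x_1),\cdots,\alpha(x_{n-1}),[y_1,\cdots,y_n])+(-1)^{|f||X|}[\alpha(x_1),\cdots,\alpha(x_{n-1}),f(y_1,\cdots,y_n)]\\&-\sum_{i=1}^n(-1)^{|X|(|y_1|+\cdots+|y_{i-1}|)}f(\alpha(y_1),\cdots,[x_1,\cdots,x_{n-1},y_i],\cdots,\alpha(y_n))\\&-\sum_{i=1}^n(-1)^{(|f|+|X|)(|y_1|+\cdots+|y_{i-1}|)}[\alpha(y_1),\cdots,f(x_1,\cdots,x_{n-1},y_i),\cdots,\alpha(y_n)].\end{aligned}$$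 Both are extended linearly. $Z^2(\mathfrak g,\mathfrak g)=\ker\delta^2$, $B^2(\mathfrak g,\mathfrak g)=\delta^1C^1(\mathfrak g,\mathfrak g)\subseteq Z^2(\mathfrak g,\mathfrak g)$ and $H^2(\mathfrak g,\mathfrak g)=Z^2(\mathfrak g,\mathfrak g)/B^2(\mathfrak g,\mathfrak g)$. *)

theory Defs
  imports Main "HOL-Library.Z2" "HOL-Computational_Algebra.Formal_Power_Series"
begin

text \<open>
  Degrees live in the two-element field \<^typ>\<open>bit\<close>, so sums and products of degrees are taken in it.
  The ground ring is a general commutative ring, so that the same notions serve both for vector
  spaces over a field \<open>K\<close> and for modules over \<open>K[[t]]\<close>.
\<close>

locale graded_module = module scale
  for scale :: "'r::comm_ring_1 \<Rightarrow> 'v::ab_group_add \<Rightarrow> 'v" +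
  fixes gr :: "bit \<Rightarrow> 'v set"
  assumes subspace_gr: "subspace (gr d)"
    and gr_sum: "\<exists>a\<in>gr 0. \<exists>b\<in>gr 1. x = a + b"
    and gr_inter: "gr 0 \<inter> gr 1 = {0}"

text \<open>\<open>homog gr ds xs\<close>: the entries of \<open>xs\<close> are homogeneous of the degrees listed in \<open>ds\<close>
  (so the zero vector is homogeneous of both degrees).\<close>

definition homog :: "(bit \<Rightarrow> 'v set) \<Rightarrow> bit list \<Rightarrow> 'v list \<Rightarrow> bool" where
  "homog gr ds xs \<longleftrightarrow> list_all2 (\<lambda>d x. x \<in> gr d) ds xs"

text \<open>\<open>sgnd d v\<close> is \<open>(-1)\<^sup>d v\<close>.\<close>

definition sgnd :: "bit \<Rightarrow> 'v::ab_group_add \<Rightarrow> 'v" where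
  "sgnd d v = (if d = 0 then v else - v)"

definition even_linear ::
  "('r::comm_ring_1 \<Rightarrow> 'v::ab_group_add \<Rightarrow> 'v) \<Rightarrow> (bit \<Rightarrow> 'v set) \<Rightarrow> ('v \<Rightarrow> 'v) \<Rightarrow> bool" where
  "even_linear scale gr \<phi> \<longleftrightarrow> module_hom scale scale \<phi> \<and> (\<forall>d. \<forall>x\<in>gr d. \<phi> x \<in> gr d)"

text \<open>An \<open>n\<close>-ary map is a function on lists, only its values on lists of length \<open>n\<close> being
  meaningful. It is set to 0 elsewhere, so that equality of functions is equality of
  \<open>n\<close>-ary maps. List positions are counted from 0.\<close>

definition nlinear ::
  "('r::comm_ring_1 \<Rightarrow> 'v::ab_group_add \<Rightarrow> 'v) \<Rightarrow> nat \<Rightarrow> ('v list \<Rightarrow> 'v) \<Rightarrow> bool" where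
  "nlinear scale n f \<longleftrightarrow>
     (\<forall>xs. length xs \<noteq> n \<longrightarrow> f xs = 0) \<and>
     (\<forall>xs i. length xs = n \<longrightarrow> i < n \<longrightarrow> module_hom scale scale (\<lambda>v. f (xs[i := v])))"

definition super_skew :: "(bit \<Rightarrow> 'v::ab_group_add set) \<Rightarrow> nat \<Rightarrow> ('v list \<Rightarrow> 'v) \<Rightarrow> bool" where
  "super_skew gr n f \<longleftrightarrow>
     (\<forall>ds xs i. length xs = n \<longrightarrow> homog gr ds xs \<longrightarrow> Suc i < n \<longrightarrow>
        f xs = - sgnd (ds ! i * ds ! Suc i) (f (xs[i := xs ! Suc i, Suc i := xs ! i])))"

locale hom_nambu_lie_superalgebra = graded_module scale gr
  for scale :: "'r::comm_ring_1 \<Rightarrow> 'v::ab_group_add \<Rightarrow> 'v" and gr :: "bit \<Rightarrow> 'v set" +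
  fixes n :: nat and br :: "'v list \<Rightarrow> 'v" and \<alpha> :: "'v \<Rightarrow> 'v"
  assumes nlinear_br: "nlinear scale n br"
    and even_linear_alpha: "even_linear scale gr \<alpha>"
    and br_degree: "\<lbrakk>length xs = n; homog gr ds xs\<rbrakk> \<Longrightarrow> br xs \<in> gr (sum_list ds)"
    and br_super_skew: "super_skew gr n br"
    and br_hom_nambu:
      "\<lbrakk>length xs = n - 1; length ys = n; homog gr dx xs; homog gr dy ys\<rbrakk> \<Longrightarrow>
        br (map \<alpha> xs @ [br ys]) =
        (\<Sum>i<n. sgnd (sum_list dx * sum_list (take i dy))
                  (br ((map \<alpha> ys)[i := br (xs @ [ys ! i])])))"
    and br_multiplicative: "length xs = n \<Longrightarrow> \<alpha> (br xs) = br (map \<alpha> xs)"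


section \<open>Cohomology\<close>

text \<open>The component of degree \<open>d\<close> of a vector.\<close>

definition comp_vec :: "(bit \<Rightarrow> 'v::ab_group_add set) \<Rightarrow> bit \<Rightarrow> 'v \<Rightarrow> 'v" where
  "comp_vec gr d x = (THE y. y \<in> gr d \<and> x - y \<in> gr (d + 1))"

definition comp_vecs :: "(bit \<Rightarrow> 'v::ab_group_add set) \<Rightarrow> bit list \<Rightarrow> 'v list \<Rightarrow> 'v list" where
  "comp_vecs gr ds xs = map2 (comp_vec gr) ds xs"

text \<open>The components of degree \<open>e\<close> of a linear and of an \<open>n\<close>-linear map: on homogeneous arguments,
  of total degree \<open>s\<close>, they are the component of degree \<open>e + s\<close> of the value; on
  other arguments they are given by (multi)linear extension.\<close>

definition comp_lin ::
  "(bit \<Rightarrow> 'v::ab_group_add set) \<Rightarrow> bit \<Rightarrow> ('v \<Rightarrow> 'v) \<Rightarrow> 'v \<Rightarrow> 'v" where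
  "comp_lin gr e \<phi> x = (\<Sum>d\<in>UNIV. comp_vec gr (e + d) (\<phi> (comp_vec gr d x)))"

definition comp_nlin ::
  "(bit \<Rightarrow> 'v::ab_group_add set) \<Rightarrow> bit \<Rightarrow> ('v list \<Rightarrow> 'v) \<Rightarrow> 'v list \<Rightarrow> 'v" where
  "comp_nlin gr e f xs =
     (\<Sum>ds | length ds = length xs. comp_vec gr (e + sum_list ds) (f (comp_vecs gr ds xs)))"

definition cochains1 ::
  "('r::comm_ring_1 \<Rightarrow> 'v::ab_group_add \<Rightarrow> 'v) \<Rightarrow> ('v \<Rightarrow> 'v) \<Rightarrow> ('v \<Rightarrow> 'v) set" where
  "cochains1 scale \<alpha> = {\<phi>. module_hom scale scale \<phi> \<and> \<phi> \<circ> \<alpha> = \<alpha> \<circ> \<phi>}"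

definition cochains2 ::
  "('r::comm_ring_1 \<Rightarrow> 'v::ab_group_add \<Rightarrow> 'v) \<Rightarrow> (bit \<Rightarrow> 'v set) \<Rightarrow> nat \<Rightarrow> ('v \<Rightarrow> 'v) \<Rightarrow>
    ('v list \<Rightarrow> 'v) set" where
  "cochains2 scale gr n \<alpha> =
     {f. nlinear scale n f \<and> super_skew gr n f \<and>
         (\<forall>xs. length xs = n \<longrightarrow> \<alpha> (f xs) = f (map \<alpha> xs))}"

text \<open>The defining formulas of the coboundary operators, for a cochain of degree \<open>e\<close> and homogeneous
  arguments whose degrees are \<open>ds\<close>, respectively \<open>dx\<close> and \<open>dy\<close>.\<close>

definition delta1_homog ::
  "nat \<Rightarrow> ('v::ab_group_add list \<Rightarrow> 'v) \<Rightarrow> bit \<Rightarrow> ('v \<Rightarrow> 'v) \<Rightarrow> bit list \<Rightarrow> 'v list \<Rightarrow> 'v" where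
  "delta1_homog n br e \<phi> ds xs =
     - \<phi> (br xs) + (\<Sum>i<n. sgnd (e * sum_list (take i ds)) (br (xs[i := \<phi> (xs ! i)])))"

definition delta2_homog ::
  "nat \<Rightarrow> ('v::ab_group_add list \<Rightarrow> 'v) \<Rightarrow> ('v \<Rightarrow> 'v) \<Rightarrow> bit \<Rightarrow> ('v list \<Rightarrow> 'v) \<Rightarrow>
    bit list \<Rightarrow> 'v list \<Rightarrow> bit list \<Rightarrow> 'v list \<Rightarrow> 'v" where
  "delta2_homog n br \<alpha> e f dx xs dy ys =
     f (map \<alpha> xs @ [br ys])
     + sgnd (e * sum_list dx) (br (map \<alpha> xs @ [f ys]))
     - (\<Sum>i<n. sgnd (sum_list dx * sum_list (take i dy))
                 (f ((map \<alpha> ys)[i := br (xs @ [ys ! i])])))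
     - (\<Sum>i<n. sgnd ((e + sum_list dx) * sum_list (take i dy))
                 (br ((map \<alpha> ys)[i := f (xs @ [ys ! i])])))"

text \<open>The coboundary operators, extended linearly to inhomogeneous cochains and
  multilinearly to inhomogeneous arguments.\<close>

definition delta1 ::
  "(bit \<Rightarrow> 'v::ab_group_add set) \<Rightarrow> nat \<Rightarrow> ('v list \<Rightarrow> 'v) \<Rightarrow> ('v \<Rightarrow> 'v) \<Rightarrow> 'v list \<Rightarrow> 'v" where
  "delta1 gr n br \<phi> xs =
     (\<Sum>e\<in>UNIV. \<Sum>ds | length ds = length xs.
        delta1_homog n br e (comp_lin gr e \<phi>) ds (comp_vecs gr ds xs))"

definition delta2 ::
  "(bit \<Rightarrow> 'v::ab_group_add set) \<Rightarrow> nat \<Rightarrow> ('v list \<Rightarrow> 'v) \<Rightarrow> ('v \<Rightarrow> 'v) \<Rightarrow>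
    ('v list \<Rightarrow> 'v) \<Rightarrow> 'v list \<Rightarrow> 'v list \<Rightarrow> 'v" where
  "delta2 gr n br \<alpha> f xs ys =
     (\<Sum>e\<in>UNIV. \<Sum>dx | length dx = length xs. \<Sum>dy | length dy = length ys.
        delta2_homog n br \<alpha> e (comp_nlin gr e f) dx (comp_vecs gr dx xs) dy (comp_vecs gr dy ys))"

definition cocycles2 ::
  "('r::comm_ring_1 \<Rightarrow> 'v::ab_group_add \<Rightarrow> 'v) \<Rightarrow> (bit \<Rightarrow> 'v set) \<Rightarrow> nat \<Rightarrow> ('v list \<Rightarrow> 'v) \<Rightarrow>
    ('v \<Rightarrow> 'v) \<Rightarrow> ('v list \<Rightarrow> 'v) set" where
  "cocycles2 scale gr n br \<alpha> =
     {f \<in> cochains2 scale gr n \<alpha>.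
        \<forall>xs ys. length xs = n - 1 \<longrightarrow> length ys = n \<longrightarrow> delta2 gr n br \<alpha> f xs ys = 0}"

definition coboundaries2 ::
  "('r::comm_ring_1 \<Rightarrow> 'v::ab_group_add \<Rightarrow> 'v) \<Rightarrow> (bit \<Rightarrow> 'v set) \<Rightarrow> nat \<Rightarrow> ('v list \<Rightarrow> 'v) \<Rightarrow>
    ('v \<Rightarrow> 'v) \<Rightarrow> ('v list \<Rightarrow> 'v) set" where
  "coboundaries2 scale gr n br \<alpha> = delta1 gr n br ` cochains1 scale \<alpha>"

definition cohomology2 ::
  "('r::comm_ring_1 \<Rightarrow> 'v::ab_group_add \<Rightarrow> 'v) \<Rightarrow> (bit \<Rightarrow> 'v set) \<Rightarrow> nat \<Rightarrow> ('v list \<Rightarrow> 'v) \<Rightarrow>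
    ('v \<Rightarrow> 'v) \<Rightarrow> ('v list \<Rightarrow> 'v) set set" where
  "cohomology2 scale gr n br \<alpha> =
     cocycles2 scale gr n br \<alpha> //
       {(f, g). f \<in> cocycles2 scale gr n br \<alpha> \<and> g \<in> cocycles2 scale gr n br \<alpha> \<and>
                (\<lambda>xs. f xs - g xs) \<in> coboundaries2 scale gr n br \<alpha>}"

text \<open>The zero element of the quotient is the class consisting of all the coboundaries.\<close>

definition cohomology2_trivial ::
  "('r::comm_ring_1 \<Rightarrow> 'v::ab_group_add \<Rightarrow> 'v) \<Rightarrow> (bit \<Rightarrow> 'v set) \<Rightarrow> nat \<Rightarrow> ('v list \<Rightarrow> 'v) \<Rightarrow>
    ('v \<Rightarrow> 'v) \<Rightarrow> bool" where
  "cohomology2_trivial scale gr n br \<alpha> \<longleftrightarrow>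
     cohomology2 scale gr n br \<alpha> = {coboundaries2 scale gr n br \<alpha>}"


section \<open>Deformations\<close>

text \<open>The \<open>K[[t]]\<close>-module \<open>g[[t]]\<close> is the type of formal power series with coefficients in \<open>g\<close>;
  its homogeneous elements are the series with homogeneous coefficients of one fixed degree.\<close>

definition fps_scale ::
  "('k::comm_ring_1 \<Rightarrow> 'v::ab_group_add \<Rightarrow> 'v) \<Rightarrow> 'k fps \<Rightarrow> 'v fps \<Rightarrow> 'v fps" where
  "fps_scale scale a X = Abs_fps (\<lambda>m. \<Sum>i\<le>m. scale (fps_nth a i) (fps_nth X (m - i)))"

definition fps_grading :: "(bit \<Rightarrow> 'v set) \<Rightarrow> bit \<Rightarrow> 'v fps set" where
  "fps_grading gr d = {X. \<forall>m. fps_nth X m \<in> gr d}"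

text \<open>The extensions to \<open>g[[t]]\<close> of a linear map \<open>\<alpha>\<close>, of a series of linear maps
  \<open>\<Sum>\<^sub>i \<phi>\<^sub>i t\<^sup>i\<close>, and of a series of \<open>n\<close>-linear maps \<open>\<Sum>\<^sub>p f\<^sub>p t\<^sup>p\<close>. In the last one, \<open>ks\<close> lists
  the exponents of the chosen coefficients of the arguments.\<close>

definition fps_extend :: "('v \<Rightarrow> 'v) \<Rightarrow> 'v fps \<Rightarrow> 'v fps" where
  "fps_extend \<alpha> X = Abs_fps (\<lambda>m. \<alpha> (fps_nth X m))"

definition fps_lin_series :: "(nat \<Rightarrow> 'v::ab_group_add \<Rightarrow> 'v) \<Rightarrow> 'v fps \<Rightarrow> 'v fps" where
  "fps_lin_series \<phi> X = Abs_fps (\<lambda>m. \<Sum>i\<le>m. \<phi> i (fps_nth X (m - i)))"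

definition fps_nlin_series ::
  "(nat \<Rightarrow> 'v::ab_group_add list \<Rightarrow> 'v) \<Rightarrow> 'v fps list \<Rightarrow> 'v fps" where
  "fps_nlin_series f Xs =
     Abs_fps (\<lambda>m. \<Sum>(p, ks) | length ks = length Xs \<and> p + sum_list ks = m.
                    f p (map2 fps_nth Xs ks))"

definition deformation ::
  "('k::field \<Rightarrow> 'v::ab_group_add \<Rightarrow> 'v) \<Rightarrow> (bit \<Rightarrow> 'v set) \<Rightarrow> nat \<Rightarrow> ('v list \<Rightarrow> 'v) \<Rightarrow>
    ('v \<Rightarrow> 'v) \<Rightarrow> (nat \<Rightarrow> 'v list \<Rightarrow> 'v) \<Rightarrow> bool" where
  "deformation scale gr n br \<alpha> f \<longleftrightarrow>
     (\<forall>p. nlinear scale n (f p)) \<and> f 0 = br \<and>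
     hom_nambu_lie_superalgebra (fps_scale scale) (fps_grading gr) n
       (fps_nlin_series f) (fps_extend \<alpha>)"

definition null_deformation :: "('v::ab_group_add list \<Rightarrow> 'v) \<Rightarrow> nat \<Rightarrow> 'v list \<Rightarrow> 'v" where
  "null_deformation br p = (if p = 0 then br else (\<lambda>_. 0))"

definition equivalent_deformations ::
  "('k::field \<Rightarrow> 'v::ab_group_add \<Rightarrow> 'v) \<Rightarrow> (bit \<Rightarrow> 'v set) \<Rightarrow> nat \<Rightarrow> ('v \<Rightarrow> 'v) \<Rightarrow>
    (nat \<Rightarrow> 'v list \<Rightarrow> 'v) \<Rightarrow> (nat \<Rightarrow> 'v list \<Rightarrow> 'v) \<Rightarrow> bool" where
  "equivalent_deformations scale gr n \<alpha> f f' \<longleftrightarrow>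
     (\<exists>\<phi> :: nat \<Rightarrow> 'v \<Rightarrow> 'v.
        (\<forall>i. even_linear scale gr (\<phi> i) \<and> \<phi> i \<circ> \<alpha> = \<alpha> \<circ> \<phi> i) \<and>
        \<phi> 0 = id \<and>
        bij (fps_lin_series \<phi>) \<and>
        (\<forall>Xs. length Xs = n \<longrightarrow>
           fps_lin_series \<phi> (fps_nlin_series f Xs) =
           fps_nlin_series f' (map (fps_lin_series \<phi>) Xs)))"

definition analytically_rigid ::
  "('k::field \<Rightarrow> 'v::ab_group_add \<Rightarrow> 'v) \<Rightarrow> (bit \<Rightarrow> 'v set) \<Rightarrow> nat \<Rightarrow> ('v list \<Rightarrow> 'v) \<Rightarrow>
    ('v \<Rightarrow> 'v) \<Rightarrow> bool" where
  "analytically_rigid scale gr n br \<alpha> \<longleftrightarrow>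
     (\<forall>f. deformation scale gr n br \<alpha> f \<longrightarrow>
          equivalent_deformations scale gr n \<alpha> f (null_deformation br))"

end

(* Over K[[t]] write F for the deformed bracket and G for the extension of the undeformed one. The
   coefficients of Phi = sum phi_i t^i are found one after the other. If the discrepancy
   Phi(F X) - G(Phi X) vanishes below t^r, its coefficient of t^r on constant arguments is an even
   2-cocycle: apply Phi to the Hom-Nambu identity of F, expand both nested brackets to order t^r, and
   subtract the Hom-Nambu identity of G at Phi X. A cochain psi bounding this cocycle can be chosen
   even, and replacing phi_r by phi_r + psi cancels the coefficient. No inverse of Phi and no
   intermediate deformations are needed. *)

theory Submission imports Defs
begin

section \<open>Multilinear maps on lists\<close>

text \<open>Write D for the discrepancy. Pushing Phi through a nested bracket gives Phi(F(Z, F W)) =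
  G(Phi Z, G(Phi W)) + G(Phi Z, D W) + D(Z, F W). If D is a multiple of t^r, the last two terms at
  order t^r see only constant coefficients and become [Z, D W] and D(Z, [W]), the two kinds of terms
  in the formula for delta2. The obstacle is the mismatch of arguments: cochains live on g and not
  on g[[t]], and the identities with signs hold only for homogeneous vectors. It is overcome one
  slot at a time. Splitting X = X_0 + t X' and using K[[t]]-linearity alone reduces any fixed
  coefficient of a multilinear map to values at constants, so F is never expanded into its
  components; splitting by degree reduces further to homogeneous constants.\<close>

lemma nlinear_hom:
  "\<lbrakk>nlinear scale n f; length xs = n; i < n\<rbrakk> \<Longrightarrow> module_hom scale scale (\<lambda>v. f (xs[i := v]))"
  by (simp add: nlinear_def)

lemma nlinear_length: "\<lbrakk>nlinear scale n f; length xs \<noteq> n\<rbrakk> \<Longrightarrow> f xs = 0"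
  by (simp add: nlinear_def)

lemma nlinear_add:
  "\<lbrakk>nlinear scale n f; length xs = n; i < n\<rbrakk> \<Longrightarrow> f (xs[i := u + v]) = f (xs[i := u]) + f (xs[i := v])"
  by (rule module_hom.add[OF nlinear_hom])

lemma nlinear_scale:
  "\<lbrakk>nlinear scale n f; length xs = n; i < n\<rbrakk> \<Longrightarrow> f (xs[i := scale c u]) = scale c (f (xs[i := u]))"
  by (rule module_hom.scale[OF nlinear_hom])

lemma nlinear_sum:
  "\<lbrakk>nlinear scale n f; length xs = n; i < n\<rbrakk> \<Longrightarrow> f (xs[i := sum g I]) = (\<Sum>a\<in>I. f (xs[i := g a]))"
  by (rule module_hom.sum[OF nlinear_hom])

lemma nlinear_zero:
  assumes "nlinear scale n f" "length xs = n" "i < n" "xs ! i = 0"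
  shows "f xs = 0"
  using module_hom.zero[OF nlinear_hom[OF assms(1-3)]] assms(4) by (metis list_update_id)

text \<open>Multilinear identities are extended one slot at a time from generators \<open>S j\<close> to the
  vectors of \<open>T j\<close>.\<close>

lemma slotwise_induct [consumes 2, case_names subset base step]:
  assumes "length xs = n" and "\<And>j. j < n \<Longrightarrow> xs ! j \<in> T j"
    and sub: "\<And>j. j < n \<Longrightarrow> S j \<subseteq> T j"
    and base: "\<And>ys. \<lbrakk>length ys = n; \<And>j. j < n \<Longrightarrow> ys ! j \<in> S j\<rbrakk> \<Longrightarrow> P ys"
    and step: "\<And>ys i. \<lbrakk>length ys = n; \<And>j. j < n \<Longrightarrow> ys ! j \<in> T j; i < n;
                 \<And>s. s \<in> S i \<Longrightarrow> P (ys[i := s])\<rbrakk> \<Longrightarrow> P ys"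
  shows "P xs"
proof -
  \<comment> \<open>Induction on k, the number of leading slots already allowed to range over
    \<open>T\<close>; the remaining slots still hold generators.\<close>
  have "P ys" if "k \<le> n" "length ys = n" "\<And>j. j < n \<Longrightarrow> ys ! j \<in> T j"
    "\<And>j. j < n \<Longrightarrow> k \<le> j \<Longrightarrow> ys ! j \<in> S j" for k ys
    using that
  proof (induction k arbitrary: ys)
    case 0
    then show ?case by (auto intro: base)
  next
    case (Suc k)
    show ?case
    proof (rule step[of ys k])
      fix s assume s: "s \<in> S k"
      show "P (ys[k := s])"
      proof (rule Suc.IH)
        fix j assume "j < n"
        then show "ys[k := s] ! j \<in> T j"
          using Suc.prems s sub[of k] by (cases "j = k") auto
        assume "k \<le> j"
        then show "ys[k := s] ! j \<in> S j"
          using Suc.prems s \<open>j < n\<close> by (cases "j = k") auto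
      qed (use Suc.prems in auto)
    qed (use Suc.prems in auto)
  qed
  from this[of n xs] assms(1,2) show ?thesis by simp
qed


section \<open>Signs and homogeneous lists\<close>

lemma bit_add_self [simp]: "d + d = (0::bit)" "d + (d + e) = (e::bit)"
  by (cases d; cases e; simp)+

declare add_bit_eq_xor [simp del] mult_bit_eq_and [simp del]

lemma UNIV_bit: "UNIV = {0, 1::bit}"
  by (auto intro: bit.exhaust)

lemma finite_bit_lists [simp]: "finite {ds :: bit list. length ds = n}"
proof -
  have "finite (UNIV :: bit set)" by (simp add: UNIV_bit)
  from finite_lists_length_eq[OF this, of n] show ?thesis by simp
qed

lemma sgnd_0 [simp]: "sgnd 0 v = v" and sgnd_zero [simp]: "sgnd d 0 = 0"
  by (simp_all add: sgnd_def)

lemma sgnd_add: "sgnd d (u + v) = sgnd d u + sgnd d v"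
  by (simp add: sgnd_def)

lemma sgnd_sum: "sgnd d (sum g I) = (\<Sum>a\<in>I. sgnd d (g a))"
  by (simp add: sgnd_def sum_negf)

lemma module_hom_sgnd:
  assumes "module_hom s1 s2 \<phi>"
  shows "\<phi> (sgnd d v) = sgnd d (\<phi> v)"
  using module_hom.neg[OF assms] by (simp add: sgnd_def)

lemma sgnd_fps_nth: "fps_nth (sgnd d X) m = sgnd d (fps_nth X m)"
  by (simp add: sgnd_def)

lemma homog_iff: "homog gr ds xs \<longleftrightarrow> length ds = length xs \<and> (\<forall>i<length xs. xs ! i \<in> gr (ds ! i))"
  by (auto simp: homog_def list_all2_conv_all_nth)

lemma homog_length: "homog gr ds xs \<Longrightarrow> length ds = length xs"
  by (simp add: homog_iff)

lemma homog_update: "\<lbrakk>homog gr ds xs; v \<in> gr d\<rbrakk> \<Longrightarrow> homog gr (ds[i := d]) (xs[i := v])"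
  unfolding homog_def by (rule list_all2_update_cong)

lemma homog_append: "\<lbrakk>homog gr ds xs; homog gr es ys\<rbrakk> \<Longrightarrow> homog gr (ds @ es) (xs @ ys)"
  by (simp add: homog_def list_all2_appendI)

lemma homog_singleton: "homog gr [d] [v] \<longleftrightarrow> v \<in> gr d"
  by (simp add: homog_def)

lemma homog_map:
  assumes "\<And>d x. x \<in> gr d \<Longrightarrow> \<phi> x \<in> gr' d" "homog gr ds xs"
  shows "homog gr' ds (map \<phi> xs)"
  using assms by (auto simp: homog_iff)

lemma sum_list_update_add:
  fixes ds :: "'a::comm_monoid_add list"
  shows "i < length ds \<Longrightarrow> sum_list (ds[i := e + ds ! i]) = e + sum_list ds"
  by (induction ds arbitrary: i) (auto split: nat.split simp: ac_simps)

lemma even_linear_hom: "even_linear scale gr \<phi> \<Longrightarrow> module_hom scale scale \<phi>"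
  and even_linear_mem: "\<lbrakk>even_linear scale gr \<phi>; x \<in> gr d\<rbrakk> \<Longrightarrow> \<phi> x \<in> gr d"
  by (auto simp: even_linear_def)

section \<open>Homogeneous components of vectors and of (multi)linear maps\<close>

context graded_module
begin

sublocale self: module_pair scale scale ..

lemmas gr_zero = subspace_0[OF subspace_gr]
  and gr_add = subspace_add[OF subspace_gr]
  and gr_diff = subspace_diff[OF subspace_gr]
  and gr_neg = subspace_neg[OF subspace_gr]
  and gr_scale = subspace_scale[OF subspace_gr]
  and gr_sum_mem = subspace_sum[OF subspace_gr]

lemma gr_sgnd: "v \<in> gr d \<Longrightarrow> sgnd e v \<in> gr d"
  by (simp add: sgnd_def gr_neg)

lemma gr_both: "\<lbrakk>v \<in> gr d; v \<in> gr (d + 1)\<rbrakk> \<Longrightarrow> v = 0"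
  using gr_inter by (cases d) auto

text \<open>Two candidates for the component differ by a vector lying in both homogeneous parts,
  hence by zero; \<open>d + 1\<close> is the opposite degree. This makes the definite description in
  \<open>comp_vec\<close> usable.\<close>

lemma comp_vec_eqI:
  assumes "y \<in> gr d" "x - y \<in> gr (d + 1)"
  shows "comp_vec gr d x = y"
  unfolding comp_vec_def
proof (rule the_equality)
  fix z assume z: "z \<in> gr d \<and> x - z \<in> gr (d + 1)"
  have "(x - y) - (x - z) \<in> gr (d + 1)"
    using z assms gr_diff by blast
  then have "z - y \<in> gr (d + 1)" by simp
  with z assms gr_diff have "z - y = 0" by (intro gr_both) auto
  then show "z = y" by simp
qed (use assms in auto)

lemma comp_vec_ex: "\<exists>y. y \<in> gr d \<and> x - y \<in> gr (d + 1)"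
proof -
  obtain a b where "a \<in> gr 0" "b \<in> gr 1" "x = a + b" using gr_sum by blast
  then show ?thesis by (cases d) (auto intro: exI[of _ a] exI[of _ b])
qed

lemma comp_vec_mem [simp]: "comp_vec gr d x \<in> gr d"
  and comp_vec_diff_mem: "x - comp_vec gr d x \<in> gr (d + 1)"
  using comp_vec_ex[of d x] comp_vec_eqI by auto

lemma comp_vec_homog: "x \<in> gr d \<Longrightarrow> comp_vec gr e x = (if e = d then x else 0)"
  by (cases e; cases d) (auto intro!: comp_vec_eqI simp: gr_zero)

lemma comp_vec_decomp: "comp_vec gr 0 x + comp_vec gr 1 x = x"
proof -
  have "comp_vec gr 1 x = x - comp_vec gr 0 x"
    by (rule comp_vec_eqI) (use comp_vec_diff_mem[of x 0] in auto)
  then show ?thesis by simp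
qed

lemma comp_vec_hom: "module_hom scale scale (comp_vec gr d)"
proof -
  have "comp_vec gr d (x + y) = comp_vec gr d x + comp_vec gr d y" for x y
    using gr_add[OF comp_vec_diff_mem[of x d] comp_vec_diff_mem[of y d]]
    by (intro comp_vec_eqI gr_add) (auto simp: algebra_simps)
  moreover have "comp_vec gr d (scale c x) = scale c (comp_vec gr d x)" for c x
    using gr_scale[OF comp_vec_diff_mem[of x d], of c]
    by (intro comp_vec_eqI gr_scale) (auto simp: scale_right_diff_distrib)
  ultimately show ?thesis by (simp add: module_hom_iff module_axioms)
qed

lemma comp_vec_even_linear:
  assumes "even_linear scale gr \<phi>"
  shows "comp_vec gr d (\<phi> x) = \<phi> (comp_vec gr d x)"
proof (rule comp_vec_eqI)
  have "\<phi> (x - comp_vec gr d x) \<in> gr (d + 1)"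
    using even_linear_mem[OF assms comp_vec_diff_mem] .
  then show "\<phi> x - \<phi> (comp_vec gr d x) \<in> gr (d + 1)"
    by (simp add: module_hom.diff[OF even_linear_hom[OF assms]])
qed (simp add: even_linear_mem[OF assms])

lemma comp_lin_homog: "\<lbrakk>module_hom scale scale \<phi>; x \<in> gr d\<rbrakk> \<Longrightarrow> comp_lin gr e \<phi> x = comp_vec gr (e + d) (\<phi> x)"
  by (cases d) (auto simp: comp_lin_def UNIV_bit comp_vec_homog module_hom.zero
      module_hom.zero[OF comp_vec_hom])

lemma comp_lin_mem: "\<lbrakk>module_hom scale scale \<phi>; x \<in> gr d\<rbrakk> \<Longrightarrow> comp_lin gr e \<phi> x \<in> gr (e + d)"
  by (simp add: comp_lin_homog)

lemma comp_lin_hom: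
  assumes "module_hom scale scale \<phi>"
  shows "module_hom scale scale (comp_lin gr e \<phi>)"
proof -
  have "module_hom scale scale (\<lambda>x. comp_vec gr (e + d) (\<phi> (comp_vec gr d x)))" for d
    using module_hom_compose[OF module_hom_compose[OF comp_vec_hom assms] comp_vec_hom]
    by (simp add: o_def)
  then show ?thesis
    unfolding comp_lin_def by (intro self.module_hom_sum) auto
qed

lemma comp_lin_even: "module_hom scale scale \<phi> \<Longrightarrow> even_linear scale gr (comp_lin gr 0 \<phi>)"
  using comp_lin_hom[of \<phi> 0] comp_lin_mem[of \<phi> _ _ 0] by (simp add: even_linear_def)

lemma comp_lin_commute:
  assumes "even_linear scale gr \<alpha>" "\<phi> \<circ> \<alpha> = \<alpha> \<circ> \<phi>"
  shows "comp_lin gr e \<phi> \<circ> \<alpha> = \<alpha> \<circ> comp_lin gr e \<phi>"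
proof
  fix x
  have "\<phi> (\<alpha> y) = \<alpha> (\<phi> y)" for y using fun_cong[OF assms(2), of y] by simp
  then show "(comp_lin gr e \<phi> \<circ> \<alpha>) x = (\<alpha> \<circ> comp_lin gr e \<phi>) x"
    by (simp add: comp_lin_def comp_vec_even_linear[OF assms(1)]
        module_hom.sum[OF even_linear_hom[OF assms(1)]])
qed

lemma comp_vecs_homog: "homog gr ds (comp_vecs gr ds xs)" if "length ds = length xs"
  using that by (auto simp: homog_iff comp_vecs_def)

lemma comp_vecs_length: "length ds = length xs \<Longrightarrow> length (comp_vecs gr ds xs) = length xs"
  by (simp add: comp_vecs_def)

lemma comp_vecs_self: "homog gr ds xs \<Longrightarrow> comp_vecs gr ds xs = xs"
  by (auto simp: homog_iff comp_vecs_def comp_vec_homog intro!: nth_equalityI)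

lemma comp_vecs_zero:
  assumes "homog gr ds xs" "length es = length xs" "es \<noteq> ds"
  shows "\<exists>i<length xs. comp_vecs gr es xs ! i = 0"
proof -
  obtain i where "i < length xs" "es ! i \<noteq> ds ! i"
    using assms by (metis homog_length nth_equalityI)
  then show ?thesis
    using assms by (auto simp: homog_iff comp_vecs_def comp_vec_homog intro!: exI[of _ i])
qed

text \<open>On homogeneous arguments only one multidegree contributes to the sums over all degree lists
  by which cochains and coboundaries are extended multilinearly.\<close>

lemma sum_degrees_homog:
  assumes "homog gr ds xs"
    and "\<And>es. \<lbrakk>length es = length xs; \<exists>i<length xs. comp_vecs gr es xs ! i = 0\<rbrakk> \<Longrightarrow> g es (comp_vecs gr es xs) = 0"
  shows "(\<Sum>es | length es = length xs. g es (comp_vecs gr es xs)) = g ds xs"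
proof -
  have "(\<Sum>es | length es = length xs. g es (comp_vecs gr es xs)) = (\<Sum>es\<in>{ds}. g es (comp_vecs gr es xs))"
    using assms homog_length[OF assms(1)] comp_vecs_zero[OF assms(1)]
    by (intro sum.mono_neutral_right) auto
  then show ?thesis by (simp add: comp_vecs_self[OF assms(1)])
qed

lemma comp_nlin_homog:
  assumes "nlinear scale n f" "length xs = n" "homog gr ds xs"
  shows "comp_nlin gr e f xs = comp_vec gr (e + sum_list ds) (f xs)"
  unfolding comp_nlin_def
proof (rule sum_degrees_homog[OF assms(3), where g = "\<lambda>es ys. comp_vec gr (e + sum_list es) (f ys)"])
  fix es :: "bit list" assume "length es = length xs" "\<exists>i<length xs. comp_vecs gr es xs ! i = 0"
  then have "f (comp_vecs gr es xs) = 0"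
    using nlinear_zero[OF assms(1)] assms(2) comp_vecs_length by metis
  then show "comp_vec gr (e + sum_list es) (f (comp_vecs gr es xs)) = 0"
    by (simp add: module_hom.zero[OF comp_vec_hom])
qed

end

section \<open>Even cochains: coboundaries, cocycles and trivial cohomology\<close>

context hom_nambu_lie_superalgebra
begin

lemmas alpha_hom = even_linear_hom[OF even_linear_alpha]
  and alpha_mem = even_linear_mem[OF even_linear_alpha]

lemma delta1_homog_mem:
  assumes "\<And>d x. x \<in> gr d \<Longrightarrow> \<phi> x \<in> gr (e + d)" "length xs = n" "homog gr ds xs"
  shows "delta1_homog n br e \<phi> ds xs \<in> gr (e + sum_list ds)"
  unfolding delta1_homog_def
proof (intro gr_add gr_neg gr_sum_mem gr_sgnd)
  show "\<phi> (br xs) \<in> gr (e + sum_list ds)"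
    using assms br_degree by auto
  fix i assume "i \<in> {..<n}"
  then have i: "i < n" by simp
  have "homog gr (ds[i := e + ds ! i]) (xs[i := \<phi> (xs ! i)])"
    using assms i by (intro homog_update) (auto simp: homog_iff)
  from br_degree[OF _ this] show "br (xs[i := \<phi> (xs ! i)]) \<in> gr (e + sum_list ds)"
    using assms i by (simp add: sum_list_update_add homog_length)
qed

lemma delta1_homog_zero:
  assumes "module_hom scale scale \<phi>" "length xs = n" "i < n" "xs ! i = 0"
  shows "delta1_homog n br e \<phi> ds xs = 0"
proof -
  have "br (xs[j := \<phi> (xs ! j)]) = 0" if "j < n" for j
    using assms that module_hom.zero[OF assms(1)]
    by (intro nlinear_zero[OF nlinear_br _ assms(3)]) (auto simp: nth_list_update)
  moreover have "br xs = 0" using nlinear_zero[OF nlinear_br assms(2-4)] .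
  ultimately show ?thesis
    by (simp add: delta1_homog_def module_hom.zero[OF assms(1)])
qed

lemma delta1_on_homog:
  assumes "module_hom scale scale \<phi>" "length xs = n" "homog gr ds xs"
  shows "delta1 gr n br \<phi> xs = (\<Sum>e\<in>UNIV. delta1_homog n br e (comp_lin gr e \<phi>) ds xs)"
  unfolding delta1_def
proof (rule sum.cong[OF refl])
  fix e :: bit
  show "(\<Sum>es | length es = length xs. delta1_homog n br e (comp_lin gr e \<phi>) es (comp_vecs gr es xs))
    = delta1_homog n br e (comp_lin gr e \<phi>) ds xs"
  proof (rule sum_degrees_homog[OF assms(3)])
    fix es :: "bit list" assume es: "length es = length xs" "\<exists>i<length xs. comp_vecs gr es xs ! i = 0"
    then obtain i where "i < n" "comp_vecs gr es xs ! i = 0" using assms(2) by auto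
    then show "delta1_homog n br e (comp_lin gr e \<phi>) es (comp_vecs gr es xs) = 0"
      using delta1_homog_zero[OF comp_lin_hom[OF assms(1)]] comp_vecs_length es assms(2) by metis
  qed
qed

text \<open>The components of different degrees of a coboundary do not interact, so the even component of
  any bounding cochain will do.\<close>

lemma even_coboundary:
  assumes D: "D \<in> coboundaries2 scale gr n br \<alpha>"
    and even: "\<And>ds xs. \<lbrakk>length xs = n; homog gr ds xs\<rbrakk> \<Longrightarrow> D xs \<in> gr (sum_list ds)"
  obtains \<psi> where "even_linear scale gr \<psi>" "\<psi> \<circ> \<alpha> = \<alpha> \<circ> \<psi>"
    "\<And>ds xs. \<lbrakk>length xs = n; homog gr ds xs\<rbrakk> \<Longrightarrow> D xs = - \<psi> (br xs) + (\<Sum>i<n. br (xs[i := \<psi> (xs ! i)]))"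
proof -
  obtain \<phi> where \<phi>: "module_hom scale scale \<phi>" "\<phi> \<circ> \<alpha> = \<alpha> \<circ> \<phi>" "D = delta1 gr n br \<phi>"
    using D by (auto simp: coboundaries2_def cochains1_def)
  show thesis
  proof (rule that[of "comp_lin gr 0 \<phi>"])
    fix ds xs assume xs: "length xs = n" "homog gr ds xs"
    let ?h = "\<lambda>e. delta1_homog n br e (comp_lin gr e \<phi>) ds xs"
    have mem: "?h e \<in> gr (e + sum_list ds)" for e
      using delta1_homog_mem[OF comp_lin_mem[OF \<phi>(1)] xs] .
    have eq: "D xs = ?h 0 + ?h 1"
      using delta1_on_homog[OF \<phi>(1) xs] \<phi>(3) by (simp add: UNIV_bit)
    have "D xs - ?h 0 \<in> gr (sum_list ds)" using even[OF xs] mem[of 0] gr_diff by simp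
    \<comment> \<open>The odd contribution equals \<open>D xs - ?h 0\<close>, so it lies in both
      homogeneous parts.\<close>
    then have "?h 1 = 0" using eq mem[of 1] by (intro gr_both) (auto simp: add.commute)
    then show "D xs = - comp_lin gr 0 \<phi> (br xs) + (\<Sum>i<n. br (xs[i := comp_lin gr 0 \<phi> (xs ! i)]))"
      using eq by (simp add: delta1_homog_def)
  qed (use \<phi> comp_lin_even comp_lin_commute even_linear_alpha in auto)
qed

text \<open>Every list fed to D in the formula for delta2 is homogeneous, and there the degree 0
  component of D is D itself and the degree 1 component is zero. So the sums that define
  \<open>delta2\<close> vanish term by term once the formula vanishes for D with degree 0.\<close>

lemma even_cocycleI:
  assumes D: "D \<in> cochains2 scale gr n \<alpha>"
    and even: "\<And>ds xs. \<lbrakk>length xs = n; homog gr ds xs\<rbrakk> \<Longrightarrow> D xs \<in> gr (sum_list ds)"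
    and pos: "0 < n"
    and zero: "\<And>dx xs dy ys. \<lbrakk>length xs = n - 1; length ys = n; homog gr dx xs; homog gr dy ys\<rbrakk>
      \<Longrightarrow> delta2_homog n br \<alpha> 0 D dx xs dy ys = 0"
  shows "D \<in> cocycles2 scale gr n br \<alpha>"
proof -
  have nl: "nlinear scale n D" using D by (simp add: cochains2_def)
  have comp: "comp_nlin gr e D zs = (if e = 0 then D zs else 0)" if "length zs = n" "homog gr ds zs" for e ds zs
    using comp_nlin_homog[OF nl that] comp_vec_homog[OF even[OF that]] by (cases e) auto
  have "delta2_homog n br \<alpha> e (comp_nlin gr e D) dx xs dy ys = 0"
    if xs: "length xs = n - 1" "homog gr dx xs" and ys: "length ys = n" "homog gr dy ys" for e dx xs dy ys
  proof -
    have ax: "homog gr dx (map \<alpha> xs)" and ay: "homog gr dy (map \<alpha> ys)"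
      using xs ys by (auto intro: homog_map alpha_mem)
    have xy: "homog gr (dx @ [dy ! i]) (xs @ [ys ! i])" "length (xs @ [ys ! i]) = n" if "i < n" for i
      using xs ys pos that by (auto intro!: homog_append simp: homog_singleton) (simp_all add: homog_iff)
    have hbr: "homog gr [sum_list dy] [br ys]" using br_degree[OF ys] by (simp add: homog_singleton)
    have 1: "comp_nlin gr e D (map \<alpha> xs @ [br ys]) = (if e = 0 then D (map \<alpha> xs @ [br ys]) else 0)"
      by (rule comp[OF _ homog_append[OF ax hbr]]) (use xs pos in auto)
    have 2: "comp_nlin gr e D ((map \<alpha> ys)[i := br (xs @ [ys ! i])]) =
        (if e = 0 then D ((map \<alpha> ys)[i := br (xs @ [ys ! i])]) else 0)" if "i < n" for i
      by (rule comp[OF _ homog_update[OF ay br_degree[OF xy(2,1)]]]) (use that ys in auto)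
    have 3: "comp_nlin gr e D (xs @ [ys ! i]) = (if e = 0 then D (xs @ [ys ! i]) else 0)" if "i < n" for i
      by (rule comp[OF xy(2,1)]) (use that in auto)
    have 4: "comp_nlin gr e D ys = (if e = 0 then D ys else 0)" by (rule comp[OF ys])
    show ?thesis
    proof (cases "e = 0")
      case True
      have "delta2_homog n br \<alpha> e (comp_nlin gr e D) dx xs dy ys = delta2_homog n br \<alpha> e D dx xs dy ys"
        unfolding delta2_homog_def using 1 2 3 4 True by simp
      then show ?thesis using zero[OF xs(1) ys(1) xs(2) ys(2)] True by simp
    next
      case False
      \<comment> \<open>For the odd component each remaining bracket has a zero entry.\<close>
      have "br (map \<alpha> xs @ [0]) = 0" using xs pos by (intro nlinear_zero[OF nlinear_br, of _ "n - 1"]) (auto simp: nth_append)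
      moreover have "br ((map \<alpha> ys)[i := 0]) = 0" if "i < n" for i
        using ys that by (intro nlinear_zero[OF nlinear_br, of _ i]) auto
      ultimately show ?thesis
        unfolding delta2_homog_def using 1 2 3 4 False by simp
    qed
  qed
  then have "delta2 gr n br \<alpha> D xs ys = 0" if "length xs = n - 1" "length ys = n" for xs ys
    unfolding delta2_def using that
    by (intro sum.neutral ballI) (auto simp: comp_vecs_homog comp_vecs_length)
  then show ?thesis using D by (simp add: cocycles2_def)
qed

text \<open>The class of a cocycle f is an element of the quotient, hence equal to the set of
  coboundaries; and f lies in its own class because 0 is the coboundary of 0.\<close>

lemma cocycles2_subset_coboundaries2:
  assumes "cohomology2_trivial scale gr n br \<alpha>"
  shows "cocycles2 scale gr n br \<alpha> \<subseteq> coboundaries2 scale gr n br \<alpha>"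
proof
  fix f assume f: "f \<in> cocycles2 scale gr n br \<alpha>"
  let ?B = "coboundaries2 scale gr n br \<alpha>"
  let ?R = "{(f, g). f \<in> cocycles2 scale gr n br \<alpha> \<and> g \<in> cocycles2 scale gr n br \<alpha> \<and>
                (\<lambda>xs. f xs - g xs) \<in> ?B}"
  have z: "module_hom scale scale (\<lambda>x. 0)" by (rule self.module_hom_zero)
  have "comp_lin gr e (\<lambda>x. 0) = (\<lambda>x. 0)" for e
    by (simp add: comp_lin_def module_hom.zero[OF comp_vec_hom] fun_eq_iff)
  moreover have "br (xs[i := 0]) = 0" if "i < n" for xs i
    using that nlinear_zero[OF nlinear_br, of "xs[i := 0]" i] nlinear_length[OF nlinear_br, of "xs[i := 0]"]
    by (cases "length xs = n") auto
  ultimately have "delta1 gr n br (\<lambda>x. 0) = (\<lambda>xs. 0)"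
    by (simp add: delta1_def delta1_homog_def fun_eq_iff)
  moreover have "(\<lambda>x. 0) \<in> cochains1 scale \<alpha>"
    using z module_hom.zero[OF alpha_hom] by (simp add: cochains1_def o_def)
  ultimately have "(\<lambda>xs. 0) \<in> ?B" unfolding coboundaries2_def by (metis imageI)
  then have mem: "f \<in> ?R `` {f}" using f by simp
  have eq: "?R `` {f} = ?B"
    using assms quotientI[OF f, of ?R] unfolding cohomology2_trivial_def cohomology2_def by simp
  show "f \<in> ?B" using mem unfolding eq .
qed

end


section \<open>Power series with coefficients in a module\<close>

lemma fps_scale_nth: "fps_nth (fps_scale scale a X) m = (\<Sum>i\<le>m. scale (fps_nth a i) (fps_nth X (m - i)))"
  and fps_extend_nth: "fps_nth (fps_extend \<alpha> X) m = \<alpha> (fps_nth X m)"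
  and fps_lin_series_nth: "fps_nth (fps_lin_series \<phi> X) m = (\<Sum>i\<le>m. \<phi> i (fps_nth X (m - i)))"
  by (simp_all add: fps_scale_def fps_extend_def fps_lin_series_def)

lemma fps_nlin_series_nth:
  "fps_nth (fps_nlin_series f Xs) m =
    (\<Sum>(p, ks) | length ks = length Xs \<and> p + sum_list ks = m. f p (map2 fps_nth Xs ks))"
  by (simp add: fps_nlin_series_def)

lemma fps_nth_const: "fps_nth (fps_const v) m = (if m = 0 then v else 0)"
  by simp

lemma sum_triangle_swap:
  fixes g :: "nat \<Rightarrow> nat \<Rightarrow> 'a::comm_monoid_add"
  shows "(\<Sum>i\<le>m. \<Sum>j\<le>m - i. g i j) = (\<Sum>j\<le>m. \<Sum>i\<le>m - j. g i j)"
proof -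
  have "(\<Sum>i\<le>m. \<Sum>j\<le>m - i. g i j) = (\<Sum>i\<le>m. \<Sum>j | j \<in> {..m} \<and> i + j \<le> m. g i j)"
    by (intro sum.cong) auto
  also have "\<dots> = (\<Sum>j\<le>m. \<Sum>i | i \<in> {..m} \<and> i + j \<le> m. g i j)"
    by (rule sum.swap_restrict) auto
  also have "\<dots> = (\<Sum>j\<le>m. \<Sum>i\<le>m - j. g i j)"
    by (intro sum.cong) auto
  finally show ?thesis .
qed

lemma finite_exponents: "finite {ks :: nat list. length ks = n \<and> sum_list ks = m}"
proof (rule finite_subset)
  show "{ks. length ks = n \<and> sum_list ks = m} \<subseteq> {ks. set ks \<subseteq> {..m} \<and> length ks = n}"
    using member_le_sum_list by fastforce
qed (simp add: finite_lists_length_eq)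

lemma finite_series_exponents: "finite {(p, ks :: nat list). length ks = n \<and> p + sum_list ks = m}"
proof (rule finite_subset)
  show "{(p, ks). length ks = n \<and> p + sum_list ks = m}
      \<subseteq> (\<Union>k\<le>m. {..m} \<times> {ks. length ks = n \<and> sum_list ks = k})" by auto
qed (auto intro: finite_exponents)

lemma null_series_nth:
  "fps_nth (fps_nlin_series (null_deformation br) Xs) m =
    (\<Sum>ks | length ks = length Xs \<and> sum_list ks = m. br (map2 fps_nth Xs ks))"
proof -
  let ?N = "{ks :: nat list. length ks = length Xs \<and> sum_list ks = m}"
  have "fps_nth (fps_nlin_series (null_deformation br) Xs) m =
      (\<Sum>(p, ks)\<in>Pair 0 ` ?N. null_deformation br p (map2 fps_nth Xs ks))"
    unfolding fps_nlin_series_nth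
    by (rule sum.mono_neutral_right[OF finite_series_exponents]) (auto simp: null_deformation_def)
  also have "\<dots> = (\<Sum>ks\<in>?N. br (map2 fps_nth Xs ks))"
    by (subst sum.reindex) (auto simp: inj_on_def null_deformation_def)
  finally show ?thesis .
qed

lemma sum_list_zero_replicate:
  "sum_list ks = (0::nat) \<longleftrightarrow> ks = replicate (length ks) 0"
  by (induction ks) auto

lemma map2_fps_nth_replicate: "map2 fps_nth Xs (replicate (length Xs) k) = map (\<lambda>X. fps_nth X k) Xs"
  by (induction Xs) auto

lemma fps_nlin_series_nth_0: "fps_nth (fps_nlin_series f Xs) 0 = f 0 (map (\<lambda>X. fps_nth X 0) Xs)"
proof -
  have "{(p, ks). length ks = length Xs \<and> p + sum_list ks = (0::nat)} = {(0, replicate (length Xs) 0)}"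
    using sum_list_zero_replicate by auto
  then show ?thesis by (simp add: fps_nlin_series_nth map2_fps_nth_replicate)
qed

lemma map2_fps_nth_update:
  "length ks = length Xs \<Longrightarrow> i < length Xs \<Longrightarrow>
    map2 fps_nth (Xs[i := V]) ks = (map2 fps_nth Xs ks)[i := fps_nth V (ks ! i)]"
  by (auto simp: nth_list_update intro!: nth_equalityI)

lemma map2_fps_nth_cong:
  "length ks = length Xs \<Longrightarrow> i < length Xs \<Longrightarrow>
    (map2 fps_nth Xs (ks[i := k]))[i := v] = (map2 fps_nth Xs ks)[i := v]"
  by (auto simp: nth_list_update intro!: nth_equalityI)

lemma sum_list_update_nat:
  fixes ks :: "nat list"
  shows "i < length ks \<Longrightarrow> sum_list (ks[i := k]) + ks ! i = sum_list ks + k"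
  by (induction ks arbitrary: i) (auto split: nat.split)

lemma nlinear_null_series:
  assumes br: "nlinear scale n br" and md: "module (fps_scale scale)"
  shows "nlinear (fps_scale scale) n (fps_nlin_series (null_deformation br))" (is "nlinear ?S n ?G")
proof -
  have hom: "module_hom ?S ?S (\<lambda>V. ?G (Xs[i := V]))" if Xs: "length Xs = n" and i: "i < n" for Xs i
  proof -
    have nth: "fps_nth (?G (Xs[i := V])) m =
        (\<Sum>ks | length ks = n \<and> sum_list ks = m. br ((map2 fps_nth Xs ks)[i := fps_nth V (ks ! i)]))" for V m
      unfolding null_series_nth using Xs i by (intro sum.cong) (auto simp: map2_fps_nth_update)
    have add: "?G (Xs[i := U + V]) = ?G (Xs[i := U]) + ?G (Xs[i := V])" for U V
      using Xs i by (auto simp: fps_eq_iff nth nlinear_add[OF br] simp flip: sum.distrib intro!: sum.cong)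
    have "fps_nth (?G (Xs[i := ?S a U])) m = fps_nth (?S a (?G (Xs[i := U]))) m" for a U m
    proof -
      let ?K = "\<lambda>m. {ks :: nat list. length ks = n \<and> sum_list ks = m}"
      let ?b = "\<lambda>ks k j. scale (fps_nth a j) (br ((map2 fps_nth Xs ks)[i := fps_nth U k]))"
      have "fps_nth (?G (Xs[i := ?S a U])) m = (\<Sum>ks\<in>?K m. \<Sum>j\<le>ks ! i. ?b ks (ks ! i - j) j)"
        unfolding nth using Xs i
        by (intro sum.cong) (auto simp: fps_scale_nth nlinear_sum[OF br] nlinear_scale[OF br])
      also have "\<dots> = (\<Sum>(ks, j)\<in>Sigma (?K m) (\<lambda>ks. {..ks ! i}). ?b ks (ks ! i - j) j)"
        by (rule sum.Sigma) (auto intro: finite_exponents)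
      \<comment> \<open>The exponent j contributed by the scalar series is taken out of slot i:
        lowering \<open>ks ! i\<close> by j leaves an exponent list of total m - j. The entry of
        slot i is overwritten, so the other factors do not notice the change.\<close>
      also have "\<dots> = (\<Sum>(j, ks)\<in>Sigma {..m} (\<lambda>j. ?K (m - j)). ?b ks (ks ! i) j)"
      proof (rule sum.reindex_bij_witness[where
            j = "\<lambda>(ks, j). (j, ks[i := ks ! i - j])" and i = "\<lambda>(j, ks). (ks[i := ks ! i + j], j)"])
        fix x assume x: "x \<in> Sigma (?K m) (\<lambda>ks. {..ks ! i})"
        then obtain ks j where ks: "x = (ks, j)" "length ks = n" "sum_list ks = m" "j \<le> ks ! i" by auto
        have "ks ! i \<le> sum_list ks" using ks i by (intro member_le_sum_list) auto
        then show "(case x of (ks, j) \<Rightarrow> (j, ks[i := ks ! i - j])) \<in> Sigma {..m} (\<lambda>j. ?K (m - j))"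
          using ks i sum_list_update_nat[of i ks "ks ! i - j"] by auto
      next
        fix y assume y: "y \<in> Sigma {..m} (\<lambda>j. ?K (m - j))"
        then obtain ks j where ks: "y = (j, ks)" "length ks = n" "sum_list ks = m - j" "j \<le> m" by auto
        then show "(case y of (j, ks) \<Rightarrow> (ks[i := ks ! i + j], j)) \<in> Sigma (?K m) (\<lambda>ks. {..ks ! i})"
          using i sum_list_update_nat[of i ks "ks ! i + j"] by auto
      qed (use Xs i in \<open>auto simp: map2_fps_nth_cong\<close>)
      also have "\<dots> = (\<Sum>j\<le>m. \<Sum>ks\<in>?K (m - j). ?b ks (ks ! i) j)"
        by (rule sum.Sigma[symmetric]) (auto intro: finite_exponents)
      also have "\<dots> = fps_nth (?S a (?G (Xs[i := U]))) m"
      proof -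
        \<comment> \<open>The list \<open>replicate n 0\<close> is a dummy; any linear slot of
          \<open>br\<close> supplies the module laws for \<open>scale\<close>.\<close>
        interpret module_hom scale scale "\<lambda>v. br ((replicate n 0)[i := v])"
          using nlinear_hom[OF br, of "replicate n 0" i] i by simp
        show ?thesis by (simp add: fps_scale_nth nth m1.scale_sum_right)
      qed
      finally show ?thesis .
    qed
    with add md show ?thesis by (simp add: module_hom_iff fps_eq_iff)
  qed
  have "?G Xs = 0" if "length Xs \<noteq> n" for Xs
    using that by (auto simp: fps_eq_iff null_series_nth intro!: sum.neutral nlinear_length[OF br])
  with hom show ?thesis by (simp add: nlinear_def)
qed

text \<open>That the power series form a graded module is an assumption here: it is part of what a
  deformation asserts and is discharged from there in the end.\<close>

locale series_module = graded_module scale gr + series: graded_module "fps_scale scale" "fps_grading gr"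
  for scale :: "'r::comm_ring_1 \<Rightarrow> 'v::ab_group_add \<Rightarrow> 'v" and gr
begin

abbreviation S where "S \<equiv> fps_scale scale"
abbreviation Gr where "Gr \<equiv> fps_grading gr"

lemma S_X_nth: "fps_nth (S fps_X U) (Suc k) = fps_nth U k" "fps_nth (S fps_X U) 0 = 0"
proof -
  have "fps_nth (S fps_X U) (Suc k) = (\<Sum>i\<in>{1::nat}. scale (fps_nth fps_X i) (fps_nth U (Suc k - i)))"
    unfolding fps_scale_nth by (rule sum.mono_neutral_right) auto
  then show "fps_nth (S fps_X U) (Suc k) = fps_nth U k" by simp
qed (simp add: fps_scale_nth)

text \<open>Peel off constant coefficients by X = X_0 + t X': linearity turns the factor t into a
  shift of the result, so m + 1 peelings determine coefficient m. No continuity in t is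
  involved.\<close>

lemma S_hom_nth:
  assumes "module_hom S S L"
  shows "fps_nth (L X) m = (\<Sum>k\<le>m. fps_nth (L (fps_const (fps_nth X k))) (m - k))"
proof -
  interpret module_hom S S L by fact
  have step: "fps_nth (L X) m = fps_nth (L (fps_const (fps_nth X 0))) m
      + (case m of 0 \<Rightarrow> 0 | Suc k \<Rightarrow> fps_nth (L (fps_shift 1 X)) k)" for X m
  proof -
    have "fps_nth X k = fps_nth (fps_const (fps_nth X 0) + S fps_X (fps_shift 1 X)) k" for k
      by (cases k) (simp_all add: S_X_nth)
    then have "X = fps_const (fps_nth X 0) + S fps_X (fps_shift 1 X)" by (rule fps_ext)
    then have "L X = L (fps_const (fps_nth X 0) + S fps_X (fps_shift 1 X))" by (rule arg_cong)
    then have "L X = L (fps_const (fps_nth X 0)) + S fps_X (L (fps_shift 1 X))"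
      by (simp only: add scale)
    then show ?thesis by (cases m) (simp_all add: S_X_nth)
  qed
  show ?thesis
  proof (induction m arbitrary: X)
    case 0
    then show ?case using step[of X 0] by simp
  next
    case (Suc m)
    show ?case
      by (subst sum.atMost_Suc_shift) (use step[of X "Suc m"] Suc.IH[of "fps_shift 1 X"] in simp)
  qed
qed

end


section \<open>The Hom-Nambu identity slot by slot\<close>

text \<open>The degree lists enter only through the signs. With them fixed, the expression is linear
  in every slot even at inhomogeneous arguments, so its vanishing can be tested on
  generators.\<close>

definition nambu_defect ::
  "nat \<Rightarrow> ('v::ab_group_add list \<Rightarrow> 'v) \<Rightarrow> ('v \<Rightarrow> 'v) \<Rightarrow> bit list \<Rightarrow> bit list \<Rightarrow> 'v list \<Rightarrow> 'v list \<Rightarrow> 'v" where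
  "nambu_defect n br \<alpha> dx dy xs ys = br (map \<alpha> xs @ [br ys]) -
     (\<Sum>i<n. sgnd (sum_list dx * sum_list (take i dy)) (br ((map \<alpha> ys)[i := br (xs @ [ys ! i])])))"

context graded_module
begin

lemma nlinear_compose:
  assumes "nlinear scale n f" "length xs = n" "i < n" "module_hom scale scale h"
  shows "module_hom scale scale (\<lambda>v. f (xs[i := h v]))"
  using module_hom_compose[OF assms(4) nlinear_hom[OF assms(1-3)]] by (simp add: o_def)

lemma module_hom_sgnd_compose: "module_hom scale scale h \<Longrightarrow> module_hom scale scale (\<lambda>v. sgnd d (h v))"
  by (cases "d = 0") (simp_all add: sgnd_def self.module_hom_neg)

lemma list_update_last: "length xs = n - 1 \<Longrightarrow> 0 < n \<Longrightarrow> (xs @ [u])[n - 1 := v] = xs @ [v]"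
  by (metis list_update_length)

lemma nambu_defect_hom_left:
  assumes f: "nlinear scale n f" and a: "module_hom scale scale \<alpha>"
    and xs: "length xs = n - 1" and ys: "length ys = n" and j: "j < n - 1"
  shows "module_hom scale scale (\<lambda>v. nambu_defect n f \<alpha> dx dy (xs[j := v]) ys)"
  unfolding nambu_defect_def
proof (intro self.module_hom_sub self.module_hom_sum module_hom_sgnd_compose)
  have "module_hom scale scale (\<lambda>v. f ((map \<alpha> xs @ [f ys])[j := \<alpha> v]))"
    using xs j by (intro nlinear_compose[OF f _ _ a]) auto
  then show "module_hom scale scale (\<lambda>v. f (map \<alpha> (xs[j := v]) @ [f ys]))"
    using xs j by (simp add: map_update list_update_append1)
  fix i assume "i \<in> {..<n}"
  then have "module_hom scale scale (\<lambda>v. f ((map \<alpha> ys)[i := f ((xs @ [ys ! i])[j := v])]))"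
    using xs ys j by (intro nlinear_compose[OF f] nlinear_hom[OF f]) auto
  then show "module_hom scale scale (\<lambda>v. f ((map \<alpha> ys)[i := f (xs[j := v] @ [ys ! i])]))"
    using xs j by (simp add: list_update_append1)
qed (auto simp: module_axioms)

lemma nambu_defect_hom_right:
  assumes f: "nlinear scale n f" and a: "module_hom scale scale \<alpha>"
    and xs: "length xs = n - 1" and ys: "length ys = n" and j: "j < n"
  shows "module_hom scale scale (\<lambda>v. nambu_defect n f \<alpha> dx dy xs (ys[j := v]))"
  unfolding nambu_defect_def
proof (intro self.module_hom_sub self.module_hom_sum module_hom_sgnd_compose)
  have upd: "(xs @ [u])[n - 1 := v] = xs @ [v]" if "length xs = n - 1" for u v and xs :: "'b list"
    using that j by (intro list_update_last) auto
  have "module_hom scale scale (\<lambda>v. f ((map \<alpha> xs @ [0])[n - 1 := f (ys[j := v])]))"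
    using xs ys j by (intro nlinear_compose[OF f] nlinear_hom[OF f]) auto
  then show "module_hom scale scale (\<lambda>v. f (map \<alpha> xs @ [f (ys[j := v])]))"
    using xs by (simp add: upd del: One_nat_def)
  fix i assume i: "i \<in> {..<n}"
  show "module_hom scale scale (\<lambda>v. f ((map \<alpha> (ys[j := v]))[i := f (xs @ [ys[j := v] ! i])]))"
  \<comment> \<open>In summand j the varied argument sits in the last place of the inner bracket; in
    all others it passes through \<alpha> into the outer one.\<close>
  proof (cases "i = j")
    case True
    have "module_hom scale scale (\<lambda>v. f ((map \<alpha> ys)[j := f ((xs @ [0])[n - 1 := v])]))"
      using xs ys j by (intro nlinear_compose[OF f] nlinear_hom[OF f]) auto
    then show ?thesis using True ys xs j by (simp add: upd map_update del: One_nat_def)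
  next
    case False
    have "module_hom scale scale (\<lambda>v. f ((map \<alpha> ys)[i := f (xs @ [ys ! i]), j := \<alpha> v]))"
      using ys j by (intro nlinear_compose[OF f _ _ a]) auto
    then show ?thesis using False by (simp add: map_update list_update_swap)
  qed
qed (auto simp: module_axioms)

end


section \<open>The null deformation\<close>

context series_module
begin

lemma Gr_const: "fps_const v \<in> Gr d \<longleftrightarrow> v \<in> gr d"
  by (auto simp: fps_grading_def gr_zero)

lemma homog_const: "homog gr ds xs \<Longrightarrow> homog Gr ds (map fps_const xs)"
  by (rule homog_map) (simp add: Gr_const)

lemma Gr_nth: "X \<in> Gr d \<Longrightarrow> fps_nth X m \<in> gr d"
  by (simp add: fps_grading_def)

text \<open>By \<open>S_hom_nth\<close>, a coefficient below t^r is a sum of coefficients below t^r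
  with one slot made constant. The degree list stays fixed throughout, because the Hom-Nambu defect
  vanishes only at arguments matching the degrees in its signs.\<close>

lemma vanish_from_const:
  assumes hom: "\<And>Ys i. \<lbrakk>length Ys = n; i < n\<rbrakk> \<Longrightarrow> module_hom S S (\<lambda>V. H (Ys[i := V]))"
    and Xs: "length Xs = n" "homog Gr ds Xs"
    and const: "\<And>m xs. \<lbrakk>m < r; length xs = n; homog gr ds xs\<rbrakk> \<Longrightarrow> fps_nth (H (map fps_const xs)) m = 0"
  shows "\<forall>m<r. fps_nth (H Xs) m = 0"
proof -
  have ds: "length ds = n" using Xs homog_length by metis
  show ?thesis
  proof (rule slotwise_induct[where S = "\<lambda>j. fps_const ` gr (ds ! j)" and T = "\<lambda>j. Gr (ds ! j)" and
        P = "\<lambda>Xs. \<forall>m<r. fps_nth (H Xs) m = 0", OF Xs(1)])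
    fix Ys assume Ys: "length Ys = n" "\<And>j. j < n \<Longrightarrow> Ys ! j \<in> fps_const ` gr (ds ! j)"
    define ys where "ys = map (\<lambda>X. fps_nth X 0) Ys"
    have y: "ys ! j \<in> gr (ds ! j) \<and> Ys ! j = fps_const (ys ! j)" if "j < n" for j
      using Ys(2)[OF that] Ys(1) that by (auto simp: ys_def)
    have "Ys = map fps_const ys"
      using Ys(1) y by (auto simp: ys_def intro!: nth_equalityI)
    moreover have "homog gr ds ys"
      using y ds Ys(1) by (auto simp: homog_iff ys_def)
    ultimately show "\<forall>m<r. fps_nth (H Ys) m = 0" using const[of _ ys] Ys(1) by (simp add: ys_def)
  next
    fix Ys i assume Ys: "length Ys = n" "\<And>j. j < n \<Longrightarrow> Ys ! j \<in> Gr (ds ! j)" and i: "i < n"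
      and IH: "\<And>V. V \<in> fps_const ` gr (ds ! i) \<Longrightarrow> \<forall>m<r. fps_nth (H (Ys[i := V])) m = 0"
    have "fps_nth (H (Ys[i := fps_const (fps_nth (Ys ! i) k)])) j = 0" if "j < r" for k j
      using IH[OF imageI[OF Gr_nth[OF Ys(2)[OF i]]]] that by blast
    then show "\<forall>m<r. fps_nth (H Ys) m = 0"
      using S_hom_nth[OF hom[OF Ys(1) i], of "Ys ! i"] by simp
  qed (use Xs in \<open>auto simp: homog_iff Gr_const\<close>)
qed

text \<open>When vanishing on constants is known for all degree lists, each slot can also be split
  into its two homogeneous components.\<close>

lemma vanish_from_homog_const:
  assumes hom: "\<And>Ys i. \<lbrakk>length Ys = n; i < n\<rbrakk> \<Longrightarrow> module_hom S S (\<lambda>V. H (Ys[i := V]))"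
    and Xs: "length Xs = n"
    and const: "\<And>m ds xs. \<lbrakk>m < r; length xs = n; homog gr ds xs\<rbrakk> \<Longrightarrow> fps_nth (H (map fps_const xs)) m = 0"
  shows "\<forall>m<r. fps_nth (H Xs) m = 0"
proof (rule slotwise_induct[where S = "\<lambda>j. \<Union>d. Gr d" and T = "\<lambda>_. UNIV" and
      P = "\<lambda>Xs. \<forall>m<r. fps_nth (H Xs) m = 0", OF Xs])
  fix Ys assume Ys: "length Ys = n" "\<And>j. j < n \<Longrightarrow> Ys ! j \<in> (\<Union>d. Gr d)"
  define d where "d j = (SOME e. Ys ! j \<in> Gr e)" for j
  have "Ys ! j \<in> Gr (d j)" if "j < n" for j
  proof -
    have "\<exists>e. Ys ! j \<in> Gr e" using Ys(2)[OF that] by blast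
    then show ?thesis unfolding d_def by (rule someI_ex)
  qed
  then have "homog Gr (map d [0..<n]) Ys" using Ys(1) by (auto simp: homog_iff)
  show "\<forall>m<r. fps_nth (H Ys) m = 0"
    by (rule vanish_from_const[where H = H, OF hom Ys(1) \<open>homog Gr _ Ys\<close> const])
next
  fix Ys i assume Ys: "length Ys = n" and i: "i < n"
    and IH: "\<And>V. V \<in> (\<Union>d. Gr d) \<Longrightarrow> \<forall>m<r. fps_nth (H (Ys[i := V])) m = 0"
  have "fps_nth (H (Ys[i := comp_vec Gr d (Ys ! i)])) j = 0" if "j < r" for j d
  proof -
    have "comp_vec Gr d (Ys ! i) \<in> (\<Union>d. Gr d)" by (rule UN_I[of d]) simp_all
    from IH[OF this] that show ?thesis by blast
  qed
  then show "\<forall>m<r. fps_nth (H Ys) m = 0"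
    using module_hom.add[OF hom[OF Ys i], of "comp_vec Gr 0 (Ys ! i)" "comp_vec Gr 1 (Ys ! i)"]
    by (simp add: series.comp_vec_decomp)
qed auto

end

locale series_superalgebra =
  hom_nambu_lie_superalgebra scale gr n br \<alpha> + series_module scale gr
  for scale :: "'r::comm_ring_1 \<Rightarrow> 'v::ab_group_add \<Rightarrow> 'v" and gr n br \<alpha> +
  assumes n_pos: "0 < n"
begin

abbreviation A where "A \<equiv> fps_extend \<alpha>"
abbreviation G where "G \<equiv> fps_nlin_series (null_deformation br)"

lemma A_even: "even_linear S Gr A"
  unfolding even_linear_def module_hom_iff
  using series.module_axioms alpha_mem
  by (auto simp: fps_eq_iff fps_extend_nth fps_scale_nth fps_grading_def module_hom.add[OF alpha_hom]
      module_hom.sum[OF alpha_hom] module_hom.scale[OF alpha_hom])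

lemmas G_nlinear = nlinear_null_series[OF nlinear_br series.module_axioms]

lemma A_const: "A (fps_const v) = fps_const (\<alpha> v)"
  by (simp add: fps_eq_iff fps_extend_nth module_hom.zero[OF alpha_hom])

lemma G_const:
  assumes "length xs = n"
  shows "G (map fps_const xs) = fps_const (br xs)"
proof (rule fps_ext)
  fix m show "fps_nth (G (map fps_const xs)) m = fps_nth (fps_const (br xs)) m"
  proof (cases "m = 0")
    case True
    then show ?thesis by (simp add: fps_nlin_series_nth_0 null_deformation_def o_def)
  next
    case False
    \<comment> \<open>A positive total exponent selects a higher coefficient of some constant
      series, which is zero.\<close>
    have "br (map2 fps_nth (map fps_const xs) ks) = 0" if "length ks = n" "sum_list ks = m" for ks
    proof -
      have "sum_list ks \<noteq> 0" using False that(2) by simp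
      then have "\<exists>k\<in>set ks. k \<noteq> 0" unfolding sum_list_eq_0_iff by blast
      then obtain k where k: "k \<in> set ks" "k \<noteq> 0" by blast
      obtain i where i: "i < length ks" "ks ! i = k" using k(1) unfolding in_set_conv_nth by blast
      then have "map2 fps_nth (map fps_const xs) ks ! i = 0" using assms that i k(2) by simp
      then show ?thesis using assms that i by (intro nlinear_zero[OF nlinear_br, of _ i]) simp_all
    qed
    then show ?thesis using False assms by (simp add: null_series_nth)
  qed
qed

lemma G_mem:
  assumes "length Xs = n" "homog Gr ds Xs"
  shows "G Xs \<in> Gr (sum_list ds)"
  unfolding fps_grading_def
proof (intro CollectI allI)
  fix m
  have "br (map2 fps_nth Xs ks) \<in> gr (sum_list ds)" if "length ks = n" for ks
    using assms that by (intro br_degree) (auto simp: homog_iff fps_grading_def)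
  then show "fps_nth (G Xs) m \<in> gr (sum_list ds)"
    unfolding null_series_nth using assms by (intro gr_sum_mem) auto
qed

lemma G_super_skew: "super_skew Gr n G"
  unfolding super_skew_def
proof (intro allI impI)
  fix ds Xs i assume Xs: "length Xs = n" "homog Gr ds Xs" "Suc i < n"
  \<comment> \<open>Exponents have to travel with their arguments; swapping them is an involution
    that preserves the total.\<close>
  let ?sw = "\<lambda>xs :: nat list. xs[i := xs ! Suc i, Suc i := xs ! i]"
  let ?K = "\<lambda>m. {ks :: nat list. length ks = n \<and> sum_list ks = m}"
  have sum: "sum_list (?sw ks) = sum_list ks" if "length ks = n" for ks
    using sum_list_update_nat[of i ks "ks ! Suc i"] sum_list_update_nat[of "Suc i" "ks[i := ks ! Suc i]" "ks ! i"]
      Xs(3) that by simp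
  have "fps_nth (G Xs) m = - sgnd (ds ! i * ds ! Suc i) (fps_nth (G (Xs[i := Xs ! Suc i, Suc i := Xs ! i])) m)" for m
  proof -
    have "br (map2 fps_nth Xs ks) = - sgnd (ds ! i * ds ! Suc i)
        (br (map2 fps_nth (Xs[i := Xs ! Suc i, Suc i := Xs ! i]) (?sw ks)))" if "ks \<in> ?K m" for ks
    proof -
      have "homog gr ds (map2 fps_nth Xs ks)"
        using Xs that by (auto simp: homog_iff fps_grading_def)
      moreover have "map2 fps_nth (Xs[i := Xs ! Suc i, Suc i := Xs ! i]) (?sw ks) =
          (map2 fps_nth Xs ks)[i := map2 fps_nth Xs ks ! Suc i, Suc i := map2 fps_nth Xs ks ! i]"
        using Xs that by (auto simp: nth_list_update intro!: nth_equalityI)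
      ultimately show ?thesis
        using br_super_skew Xs that unfolding super_skew_def by auto
    qed
    then have "fps_nth (G Xs) m = (\<Sum>ks\<in>?K m. - sgnd (ds ! i * ds ! Suc i)
        (br (map2 fps_nth (Xs[i := Xs ! Suc i, Suc i := Xs ! i]) (?sw ks))))"
      unfolding null_series_nth using Xs(1) by simp
    also have "\<dots> = (\<Sum>ks\<in>?K m. - sgnd (ds ! i * ds ! Suc i)
        (br (map2 fps_nth (Xs[i := Xs ! Suc i, Suc i := Xs ! i]) ks)))"
    proof (rule sum.reindex_bij_witness[where i = ?sw and j = ?sw])
      fix ks assume "ks \<in> ?K m"
      then have ks: "length ks = n" "sum_list ks = m" by auto
      show "?sw ks \<in> ?K m" "?sw ks \<in> ?K m" using ks sum[OF ks(1)] by simp_all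
      show "?sw (?sw ks) = ks" "?sw (?sw ks) = ks"
        using ks Xs(3) by (intro nth_equalityI; simp add: nth_list_update)+
    qed simp
    also have "\<dots> = - sgnd (ds ! i * ds ! Suc i) (fps_nth (G (Xs[i := Xs ! Suc i, Suc i := Xs ! i])) m)"
      unfolding null_series_nth using Xs(1) by (simp add: sgnd_sum sum_negf)
    finally show ?thesis .
  qed
  then show "G Xs = - sgnd (ds ! i * ds ! Suc i) (G (Xs[i := Xs ! Suc i, Suc i := Xs ! i]))"
    by (simp add: fps_eq_iff sgnd_fps_nth)
qed

text \<open>On constants this is the identity for \<open>br\<close>. It is spread to series in the
  first block with the second block still constant, then to series in the second.\<close>

lemma G_hom_nambu:
  assumes "length Xs = n - 1" "length Ys = n" "homog Gr dx Xs" "homog Gr dy Ys"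
  shows "nambu_defect n G A dx dy Xs Ys = 0"
proof -
  let ?N = "nambu_defect n G A dx dy"
  note Ahom = even_linear_hom[OF A_even]
  have const: "?N (map fps_const xs) (map fps_const ys) = 0"
    if xs: "length xs = n - 1" "homog gr dx xs" and ys: "length ys = n" "homog gr dy ys" for xs ys
  proof -
    have 1: "G (map A (map fps_const xs) @ [G (map fps_const ys)]) = fps_const (br (map \<alpha> xs @ [br ys]))"
      using G_const[of "map \<alpha> xs @ [br ys]"] xs ys n_pos by (simp add: G_const A_const o_def)
    have 2: "G ((map A (map fps_const ys))[i := G (map fps_const xs @ [map fps_const ys ! i])]) =
        fps_const (br ((map \<alpha> ys)[i := br (xs @ [ys ! i])]))" if "i < n" for i
      using G_const[of "(map \<alpha> ys)[i := br (xs @ [ys ! i])]"] G_const[of "xs @ [ys ! i]"] xs ys n_pos that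
      by (simp add: A_const o_def map_update)
    have 3: "fps_const (sgnd d v) = sgnd d (fps_const v)" for d and v :: 'v
      by (simp add: sgnd_def)
    have "fps_const (\<Sum>i<n. g i) = (\<Sum>i<n. fps_const (g i))" for g :: "nat \<Rightarrow> 'v"
      by (simp add: fps_eq_iff fps_sum_nth)
    then have "(\<Sum>i<n. sgnd (sum_list dx * sum_list (take i dy))
          (G ((map A (map fps_const ys))[i := G (map fps_const xs @ [map fps_const ys ! i])])))
        = fps_const (\<Sum>i<n. sgnd (sum_list dx * sum_list (take i dy)) (br ((map \<alpha> ys)[i := br (xs @ [ys ! i])])))"
      by (simp only: 3) (intro sum.cong refl, simp only: 2 lessThan_iff)
    then show ?thesis
      unfolding nambu_defect_def 1 using br_hom_nambu[OF xs(1) ys(1) xs(2) ys(2)] by simp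
  qed
  have "fps_nth (?N Xs (map fps_const ys)) m = 0" if ys: "length ys = n" "homog gr dy ys" for ys m
  proof -
    have "\<forall>k<Suc m. fps_nth (?N Xs (map fps_const ys)) k = 0"
    proof (rule vanish_from_const[where H = "\<lambda>Xs. ?N Xs (map fps_const ys)", OF _ assms(1,3)])
      show "module_hom S S (\<lambda>V. ?N (Ys[i := V]) (map fps_const ys))"
        if "length Ys = n - 1" "i < n - 1" for Ys i
        by (rule series.nambu_defect_hom_left[OF G_nlinear Ahom]) (use that ys in auto)
    qed (use const ys in simp)
    then show ?thesis by simp
  qed
  note left = this
  have "fps_nth (?N Xs Ys) m = 0" for m
  proof -
    have "\<forall>k<Suc m. fps_nth (?N Xs Ys) k = 0"
    proof (rule vanish_from_const[where H = "?N Xs", OF _ assms(2,4)])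
      show "module_hom S S (\<lambda>V. ?N Xs (Ys[i := V]))" if "length Ys = n" "i < n" for Ys i
        by (rule series.nambu_defect_hom_right[OF G_nlinear Ahom]) (use that assms in auto)
    qed (use left in simp)
    then show ?thesis by simp
  qed
  then show ?thesis by (simp add: fps_eq_iff)
qed

sublocale null: hom_nambu_lie_superalgebra S Gr n G A
proof
  fix Xs Ys dx dy assume "length Xs = n - 1" "length Ys = n" "homog Gr dx Xs" "homog Gr dy Ys"
  from G_hom_nambu[OF this] show "G (map A Xs @ [G Ys]) =
        (\<Sum>i<n. sgnd (sum_list dx * sum_list (take i dy)) (G ((map A Ys)[i := G (Xs @ [Ys ! i])])))"
    by (simp add: nambu_defect_def)
next
  fix Xs :: "'v fps list" assume Xs: "length Xs = n"
  have "\<alpha> (br (map2 fps_nth Xs ks)) = br (map2 fps_nth (map A Xs) ks)" if "length ks = n" for ks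
    using Xs that by (subst br_multiplicative) (auto simp: fps_extend_nth intro!: arg_cong[of _ _ br] nth_equalityI)
  then show "A (G Xs) = G (map A Xs)"
    using Xs by (simp add: fps_eq_iff fps_extend_nth null_series_nth module_hom.sum[OF alpha_hom])
qed (fact G_nlinear A_even G_mem G_super_skew)+

end


section \<open>Series of linear maps\<close>

context series_module
begin

lemma fps_lin_series_hom:
  assumes "\<And>i. module_hom scale scale (\<phi> i)"
  shows "module_hom S S (fps_lin_series \<phi>)"
proof -
  have "fps_lin_series \<phi> (S a X) = S a (fps_lin_series \<phi> X)" for a X
  proof (rule fps_ext)
    fix m
    have "fps_nth (fps_lin_series \<phi> (S a X)) m =
        (\<Sum>i\<le>m. \<Sum>j\<le>m - i. scale (fps_nth a j) (\<phi> i (fps_nth X (m - i - j))))"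
      by (simp add: fps_lin_series_nth fps_scale_nth module_hom.sum[OF assms] module_hom.scale[OF assms])
    also have "\<dots> = (\<Sum>j\<le>m. \<Sum>i\<le>m - j. scale (fps_nth a j) (\<phi> i (fps_nth X (m - i - j))))"
      by (rule sum_triangle_swap)
    also have "\<dots> = fps_nth (S a (fps_lin_series \<phi> X)) m"
      by (simp add: fps_lin_series_nth fps_scale_nth scale_sum_right add.commute)
    finally show "fps_nth (fps_lin_series \<phi> (S a X)) m = fps_nth (S a (fps_lin_series \<phi> X)) m" .
  qed
  then show ?thesis
    unfolding module_hom_iff using series.module_axioms
    by (auto simp: fps_eq_iff fps_lin_series_nth module_hom.add[OF assms] sum.distrib)
qed

lemma fps_lin_series_even:
  assumes "\<And>i. even_linear scale gr (\<phi> i)"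
  shows "even_linear S Gr (fps_lin_series \<phi>)"
  unfolding even_linear_def
  using fps_lin_series_hom[OF even_linear_hom[OF assms]] even_linear_mem[OF assms]
  by (auto simp: fps_grading_def fps_lin_series_nth intro!: gr_sum_mem)

lemma fps_lin_series_const:
  assumes "\<And>i. module_hom scale scale (\<phi> i)"
  shows "fps_nth (fps_lin_series \<phi> (fps_const x)) m = \<phi> m x"
proof -
  have "fps_nth (fps_lin_series \<phi> (fps_const x)) m = (\<Sum>i\<in>{m}. \<phi> i (fps_nth (fps_const x) (m - i)))"
    unfolding fps_lin_series_nth
    by (rule sum.mono_neutral_right) (auto simp: module_hom.zero[OF assms])
  then show ?thesis by simp
qed

end

text \<open>The recursive solution of Phi X = Y: when \<open>\<phi> 0\<close> is the identity,
  coefficient m of the equation expresses coefficient m of X through the earlier ones.\<close>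

fun lin_series_inverse :: "(nat \<Rightarrow> 'v::ab_group_add \<Rightarrow> 'v) \<Rightarrow> 'v fps \<Rightarrow> nat \<Rightarrow> 'v" where
  "lin_series_inverse \<phi> Y m = fps_nth Y m - (\<Sum>i = 1..m. \<phi> i (lin_series_inverse \<phi> Y (m - i)))"

declare lin_series_inverse.simps [simp del]

lemma bij_fps_lin_series:
  assumes "\<phi> 0 = id"
  shows "bij (fps_lin_series \<phi>)"
proof -
  have nth: "fps_nth (fps_lin_series \<phi> X) m = fps_nth X m + (\<Sum>i = 1..m. \<phi> i (fps_nth X (m - i)))" for X m
    by (simp add: fps_lin_series_nth atMost_atLeast0 sum.atLeast_Suc_atMost assms)
  have inv: "fps_nth X m = lin_series_inverse \<phi> (fps_lin_series \<phi> X) m" for X m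
  proof (induction m rule: less_induct)
    case (less m)
    have "(\<Sum>i = 1..m. \<phi> i (lin_series_inverse \<phi> (fps_lin_series \<phi> X) (m - i)))
        = (\<Sum>i = 1..m. \<phi> i (fps_nth X (m - i)))"
      using less by (intro sum.cong) auto
    then show ?case by (subst lin_series_inverse.simps) (simp add: nth)
  qed
  have "Abs_fps (lin_series_inverse \<phi> (fps_lin_series \<phi> X)) = X" for X
    by (rule fps_ext) (simp only: fps_nth_Abs_fps inv[symmetric])
  moreover have "fps_lin_series \<phi> (Abs_fps (lin_series_inverse \<phi> Y)) = Y" for Y
  proof (rule fps_ext)
    fix m show "fps_nth (fps_lin_series \<phi> (Abs_fps (lin_series_inverse \<phi> Y))) m = fps_nth Y m"
      using lin_series_inverse.simps[of \<phi> Y m] by (simp add: nth)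
  qed
  ultimately show ?thesis
    by (intro o_bij[of "\<lambda>Y. Abs_fps (lin_series_inverse \<phi> Y)"]) (auto simp: fun_eq_iff)
qed


section \<open>The obstruction\<close>

text \<open>The deformed bracket is an abstract bracket F on series. Of its expansion only the
  constant term is recorded; linearity over power series replaces the rest.\<close>

locale series_superalgebra_deformation =
  series_superalgebra scale gr n br \<alpha> +
  deformed: hom_nambu_lie_superalgebra "fps_scale scale" "fps_grading gr" n F "fps_extend \<alpha>"
  for scale :: "'r::comm_ring_1 \<Rightarrow> 'v::ab_group_add \<Rightarrow> 'v" and gr n br \<alpha> F +
  assumes F_nth_0: "length Xs = n \<Longrightarrow> fps_nth (F Xs) 0 = br (map (\<lambda>X. fps_nth X 0) Xs)"
begin

definition admissible :: "(nat \<Rightarrow> 'v \<Rightarrow> 'v) \<Rightarrow> bool" where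
  "admissible \<phi> \<longleftrightarrow> (\<forall>i. even_linear scale gr (\<phi> i) \<and> \<phi> i \<circ> \<alpha> = \<alpha> \<circ> \<phi> i) \<and> \<phi> 0 = id"

definition discrepancy :: "(nat \<Rightarrow> 'v \<Rightarrow> 'v) \<Rightarrow> 'v fps list \<Rightarrow> 'v fps" where
  "discrepancy \<phi> Xs = fps_lin_series \<phi> (F Xs) - G (map (fps_lin_series \<phi>) Xs)"

definition obstruction :: "(nat \<Rightarrow> 'v \<Rightarrow> 'v) \<Rightarrow> nat \<Rightarrow> 'v list \<Rightarrow> 'v" where
  "obstruction \<phi> r xs = fps_nth (discrepancy \<phi> (map fps_const xs)) r"

lemma G_nth_0: "fps_nth (G Xs) 0 = br (map (\<lambda>X. fps_nth X 0) Xs)"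
  by (simp add: fps_nlin_series_nth_0 null_deformation_def)

lemma nlinear_nth_const:
  assumes "nlinear S n H"
  shows "nlinear scale n (\<lambda>xs. fps_nth (H (map fps_const xs)) r)"
proof -
  have const_scale: "fps_const (scale c v) = S (fps_const c) (fps_const v)" for c v
    by (rule fps_ext) (simp add: fps_scale_nth fps_nth_const if_distrib[of "\<lambda>a. scale a _"] sum.If_cases)
  have nth_scale: "fps_nth (S (fps_const c) X) r = scale c (fps_nth X r)" for c X
  proof -
    have "fps_nth (S (fps_const c) X) r = (\<Sum>i\<in>{0}. scale (fps_nth (fps_const c) i) (fps_nth X (r - i)))"
      unfolding fps_scale_nth by (rule sum.mono_neutral_right) auto
    then show ?thesis by simp
  qed
  have "module_hom scale scale (\<lambda>v. fps_nth (H (map fps_const (xs[i := v]))) r)" if "length xs = n" "i < n" for xs i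
  proof -
    interpret module_hom S S "\<lambda>V. H ((map fps_const xs)[i := V])"
      using nlinear_hom[OF assms] that by simp
    show ?thesis
      by (simp add: module_hom_iff module_axioms map_update add scale const_scale nth_scale flip: fps_const_add)
  qed
  then show ?thesis using nlinear_length[OF assms] by (simp add: nlinear_def)
qed

context
  fixes \<phi> assumes adm: "admissible \<phi>"
begin

abbreviation \<Phi> where "\<Phi> \<equiv> fps_lin_series \<phi>"

lemma phi_even: "even_linear scale gr (\<phi> i)" and phi_alpha: "\<phi> i (\<alpha> x) = \<alpha> (\<phi> i x)" and phi_0: "\<phi> 0 = id"
  using adm by (auto simp: admissible_def o_def fun_eq_iff)

lemmas phi_hom = even_linear_hom[OF phi_even]
  and Phi_hom = fps_lin_series_hom[OF even_linear_hom[OF phi_even]]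
  and Phi_mem = even_linear_mem[OF fps_lin_series_even[OF phi_even]]

lemma Phi_A: "\<Phi> (A X) = A (\<Phi> X)"
  by (simp add: fps_eq_iff fps_lin_series_nth fps_extend_nth phi_alpha module_hom.sum[OF alpha_hom])

lemma map_Phi_A: "map \<Phi> (map A Xs) = map A (map \<Phi> Xs)"
  by (simp add: Phi_A)

lemma Phi_nth_0: "fps_nth (\<Phi> X) 0 = fps_nth X 0"
  by (simp add: fps_lin_series_nth phi_0)

lemma discrepancy_nlinear: "nlinear S n (discrepancy \<phi>)"
proof -
  have "module_hom S S (\<lambda>V. discrepancy \<phi> (Xs[i := V]))" if "length Xs = n" "i < n" for Xs i
    unfolding discrepancy_def map_update
    using that module_hom_compose[OF nlinear_hom[OF deformed.nlinear_br that] Phi_hom]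
    by (intro series.self.module_hom_sub series.nlinear_compose[OF G_nlinear _ _ Phi_hom]) (auto simp: o_def)
  moreover have "discrepancy \<phi> Xs = 0" if "length Xs \<noteq> n" for Xs
    using that nlinear_length[OF deformed.nlinear_br] nlinear_length[OF G_nlinear] module_hom.zero[OF Phi_hom]
    by (simp add: discrepancy_def)
  ultimately show ?thesis by (simp add: nlinear_def)
qed

lemma discrepancy_mem:
  assumes "length Xs = n" "homog Gr ds Xs"
  shows "discrepancy \<phi> Xs \<in> Gr (sum_list ds)"
  unfolding discrepancy_def
  using assms homog_map[where \<phi> = \<Phi>, OF Phi_mem assms(2)]
  by (intro series.gr_diff Phi_mem deformed.br_degree G_mem) auto

lemma discrepancy_super_skew: "super_skew Gr n (discrepancy \<phi>)"
  unfolding super_skew_def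
proof (intro allI impI)
  fix ds Xs i assume Xs: "length Xs = n" "homog Gr ds Xs" "Suc i < n"
  let ?d = "ds ! i * ds ! Suc i" and ?Xs = "Xs[i := Xs ! Suc i, Suc i := Xs ! i]"
  have "F Xs = - sgnd ?d (F ?Xs)"
    by (rule deformed.br_super_skew[unfolded super_skew_def, rule_format, OF Xs])
  moreover have "G (map \<Phi> Xs) = - sgnd ?d (G (map \<Phi> ?Xs))"
    using G_super_skew[unfolded super_skew_def, rule_format,
        OF _ homog_map[where \<phi> = \<Phi>, OF Phi_mem Xs(2)] Xs(3)] Xs by (simp add: map_update)
  ultimately show "discrepancy \<phi> Xs = - sgnd ?d (discrepancy \<phi> ?Xs)"
    by (simp add: discrepancy_def module_hom.neg[OF Phi_hom] sgnd_def)
qed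

lemma discrepancy_A: "length Xs = n \<Longrightarrow> A (discrepancy \<phi> Xs) = discrepancy \<phi> (map A Xs)"
  using deformed.br_multiplicative[of Xs] null.br_multiplicative[of "map \<Phi> Xs"] Phi_A[of "F Xs"] map_Phi_A[of Xs]
  by (simp only: discrepancy_def module_hom.diff[OF even_linear_hom[OF A_even]] length_map)

context
  fixes r :: nat
  assumes below_const: "\<And>m ds xs. \<lbrakk>m < r; length xs = n; homog gr ds xs\<rbrakk> \<Longrightarrow>
    fps_nth (discrepancy \<phi> (map fps_const xs)) m = 0"
begin

lemma discrepancy_below: "\<lbrakk>length Xs = n; m < r\<rbrakk> \<Longrightarrow> fps_nth (discrepancy \<phi> Xs) m = 0"
  by (rule vanish_from_homog_const[where H = "discrepancy \<phi>", rule_format])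
    (assumption | rule nlinear_hom[OF discrepancy_nlinear] below_const)+

text \<open>Coefficient k of an argument meets coefficient r - k of the discrepancy, which is zero
  unless k = 0. So the leading term depends on constant coefficients only.\<close>

lemma discrepancy_lead:
  assumes "length Xs = n"
  shows "fps_nth (discrepancy \<phi> Xs) r = obstruction \<phi> r (map (\<lambda>X. fps_nth X 0) Xs)"
proof (rule slotwise_induct[where S = "\<lambda>_. range fps_const" and T = "\<lambda>_. UNIV" and
      P = "\<lambda>Xs. fps_nth (discrepancy \<phi> Xs) r = obstruction \<phi> r (map (\<lambda>X. fps_nth X 0) Xs)", OF assms])
  fix Ys :: "'v fps list" assume Ys: "length Ys = n" "\<And>j. j < n \<Longrightarrow> Ys ! j \<in> range fps_const"
  then have "Ys = map fps_const (map (\<lambda>X. fps_nth X 0) Ys)"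
    by (intro nth_equalityI) force+
  then show "fps_nth (discrepancy \<phi> Ys) r = obstruction \<phi> r (map (\<lambda>X. fps_nth X 0) Ys)"
    unfolding obstruction_def by metis
next
  fix Ys :: "'v fps list" and i assume Ys: "length Ys = n" and i: "i < n"
    and IH: "\<And>V. V \<in> range fps_const \<Longrightarrow>
      fps_nth (discrepancy \<phi> (Ys[i := V])) r = obstruction \<phi> r (map (\<lambda>X. fps_nth X 0) (Ys[i := V]))"
  have "fps_nth (discrepancy \<phi> Ys) r =
      (\<Sum>k\<le>r. fps_nth (discrepancy \<phi> (Ys[i := fps_const (fps_nth (Ys ! i) k)])) (r - k))"
    using S_hom_nth[OF nlinear_hom[OF discrepancy_nlinear Ys i], of "Ys ! i"] by simp
  also have "\<dots> = (\<Sum>k\<in>{0}. fps_nth (discrepancy \<phi> (Ys[i := fps_const (fps_nth (Ys ! i) k)])) (r - k))"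
    using Ys by (intro sum.mono_neutral_right) (auto intro!: discrepancy_below)
  also have "\<dots> = obstruction \<phi> r (map (\<lambda>X. fps_nth X 0) (Ys[i := fps_const (fps_nth (Ys ! i) 0)]))"
    using IH[of "fps_const (fps_nth (Ys ! i) 0)"] by simp
  also have "\<dots> = obstruction \<phi> r (map (\<lambda>X. fps_nth X 0) Ys)"
    using Ys i by (intro arg_cong[of _ _ "obstruction \<phi> r"]) (auto simp: map_update nth_list_update intro!: nth_equalityI)
  finally show "fps_nth (discrepancy \<phi> Ys) r = obstruction \<phi> r (map (\<lambda>X. fps_nth X 0) Ys)" .
qed auto

text \<open>E is a multiple of t^r, so at order r only its leading coefficient counts, and it meets
  the constant term of G, which is \<open>br\<close> at the constant coefficients of the other
  arguments.\<close>

lemma G_nth_perturb: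
  assumes "length Zs = n" "i < n" "\<And>k. k < r \<Longrightarrow> fps_nth E k = 0"
  shows "fps_nth (G (Zs[i := X + E])) r =
    fps_nth (G (Zs[i := X])) r + br ((map (\<lambda>X. fps_nth X 0) Zs)[i := fps_nth E r])"
proof -
  have hom: "module_hom S S (\<lambda>V. G (Zs[i := V]))" by (rule nlinear_hom[OF G_nlinear assms(1,2)])
  have "fps_nth (G (Zs[i := E])) r = (\<Sum>k\<le>r. fps_nth (G (Zs[i := fps_const (fps_nth E k)])) (r - k))"
    by (rule S_hom_nth[OF hom])
  also have "\<dots> = (\<Sum>k\<in>{r}. fps_nth (G (Zs[i := fps_const (fps_nth E k)])) (r - k))"
    using assms(3) module_hom.zero[OF hom] by (intro sum.mono_neutral_right) auto
  finally show ?thesis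
    by (simp add: nlinear_add[OF G_nlinear assms(1,2)] G_nth_0 map_update)
qed

text \<open>Each of the two brackets costs one discrepancy when Phi passes it. The inner one is fed
  into G by \<open>G_nth_perturb\<close>, the outer one is read off by
  \<open>discrepancy_lead\<close>; at leading order Phi is the identity and F is
  \<open>br\<close>.\<close>

lemma Phi_nested_nth:
  assumes "length Zs = n" "i < n" "length W = n"
  shows "fps_nth (\<Phi> (F (Zs[i := F W]))) r =
    fps_nth (G ((map \<Phi> Zs)[i := G (map \<Phi> W)])) r
    + br ((map (\<lambda>X. fps_nth X 0) Zs)[i := obstruction \<phi> r (map (\<lambda>X. fps_nth X 0) W)])
    + obstruction \<phi> r ((map (\<lambda>X. fps_nth X 0) Zs)[i := br (map (\<lambda>X. fps_nth X 0) W)])"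
proof -
  have W: "\<Phi> (F W) = G (map \<Phi> W) + discrepancy \<phi> W" by (simp add: discrepancy_def)
  have "\<Phi> (F (Zs[i := F W])) = G ((map \<Phi> Zs)[i := \<Phi> (F W)]) + discrepancy \<phi> (Zs[i := F W])"
    by (simp add: discrepancy_def map_update)
  moreover have "fps_nth (discrepancy \<phi> (Zs[i := F W])) r =
      obstruction \<phi> r ((map (\<lambda>X. fps_nth X 0) Zs)[i := br (map (\<lambda>X. fps_nth X 0) W)])"
    using assms by (simp add: discrepancy_lead map_update F_nth_0)
  moreover have "fps_nth (G ((map \<Phi> Zs)[i := \<Phi> (F W)])) r = fps_nth (G ((map \<Phi> Zs)[i := G (map \<Phi> W)])) r
      + br ((map (\<lambda>X. fps_nth X 0) Zs)[i := obstruction \<phi> r (map (\<lambda>X. fps_nth X 0) W)])"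
    unfolding W using assms G_nth_perturb[of "map \<Phi> Zs" i "discrepancy \<phi> W"]
    by (simp add: discrepancy_below discrepancy_lead Phi_nth_0 o_def)
  ultimately show ?thesis by simp
qed

lemma obstruction_cochain: "obstruction \<phi> r \<in> cochains2 scale gr n \<alpha>"
proof -
  have "nlinear scale n (obstruction \<phi> r)"
    using nlinear_nth_const[OF discrepancy_nlinear, of r] by (simp add: obstruction_def[abs_def])
  moreover have "super_skew gr n (obstruction \<phi> r)"
    unfolding super_skew_def
  proof (intro allI impI)
    fix ds xs i assume xs: "length xs = n" "homog gr ds xs" "Suc i < n"
    from discrepancy_super_skew[unfolded super_skew_def, rule_format, OF _ homog_const[OF xs(2)] xs(3)] xs
    show "obstruction \<phi> r xs = - sgnd (ds ! i * ds ! Suc i) (obstruction \<phi> r (xs[i := xs ! Suc i, Suc i := xs ! i]))"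
      by (simp add: obstruction_def map_update sgnd_fps_nth)
  qed
  moreover have "\<alpha> (obstruction \<phi> r xs) = obstruction \<phi> r (map \<alpha> xs)" if "length xs = n" for xs
    using arg_cong[OF discrepancy_A[of "map fps_const xs"], of "\<lambda>X. fps_nth X r"] that
    by (simp add: obstruction_def fps_extend_nth A_const o_def)
  ultimately show ?thesis by (simp add: cochains2_def)
qed

lemma obstruction_even:
  "\<lbrakk>length xs = n; homog gr ds xs\<rbrakk> \<Longrightarrow> obstruction \<phi> r xs \<in> gr (sum_list ds)"
  using discrepancy_mem[OF _ homog_const] by (simp add: obstruction_def Gr_nth)

text \<open>The left side of the identity for F yields the first two terms of delta2, the summands
  on the right yield its two sums. Since the cochain has degree 0, both sums carry exactly the signs
  of the Hom-Nambu identity.\<close>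

lemma obstruction_delta2:
  assumes xs: "length xs = n - 1" "homog gr dx xs" and ys: "length ys = n" "homog gr dy ys"
  shows "delta2_homog n br \<alpha> 0 (obstruction \<phi> r) dx xs dy ys = 0"
proof -
  let ?X = "map fps_const xs" and ?Y = "map fps_const ys"
  let ?s = "\<lambda>i. sgnd (sum_list dx * sum_list (take i dy))"
  have nth_const: "map (\<lambda>X. fps_nth X 0) (map fps_const zs) = zs" for zs :: "'v list"
    by (simp add: o_def)
  have upd: "(zs @ [u])[n - 1 := v] = zs @ [v]" if "length zs = n - 1" for zs :: "'b list" and u v
    using that n_pos by (intro list_update_last) auto
  \<comment> \<open>The inner bracket occupies slot n - 1; the appended 0 is a placeholder that gets
    overwritten.\<close>
  have L: "fps_nth (\<Phi> (F (map A ?X @ [F ?Y]))) r =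
      fps_nth (G (map A (map \<Phi> ?X) @ [G (map \<Phi> ?Y)])) r
      + br (map \<alpha> xs @ [obstruction \<phi> r ys]) + obstruction \<phi> r (map \<alpha> xs @ [br ys])"
    using Phi_nested_nth[of "map A ?X @ [0]" "n - 1" ?Y] xs ys n_pos
    by (simp add: upd A_const o_def flip: Phi_A del: One_nat_def)
  have R: "fps_nth (\<Phi> (F ((map A ?Y)[i := F (?X @ [?Y ! i])]))) r =
      fps_nth (G ((map A (map \<Phi> ?Y))[i := G (map \<Phi> ?X @ [map \<Phi> ?Y ! i])])) r
      + br ((map \<alpha> ys)[i := obstruction \<phi> r (xs @ [ys ! i])]) + obstruction \<phi> r ((map \<alpha> ys)[i := br (xs @ [ys ! i])])"
    if "i < n" for i
    using Phi_nested_nth[of "map A ?Y" i "?X @ [?Y ! i]"] xs ys n_pos that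
    by (simp add: A_const o_def flip: Phi_A)
  have "F (map A ?X @ [F ?Y]) = (\<Sum>i<n. ?s i (F ((map A ?Y)[i := F (?X @ [?Y ! i])])))"
    using xs ys by (intro deformed.br_hom_nambu homog_const) auto
  then have "fps_nth (\<Phi> (F (map A ?X @ [F ?Y]))) r =
      (\<Sum>i<n. ?s i (fps_nth (\<Phi> (F ((map A ?Y)[i := F (?X @ [?Y ! i])]))) r))"
    by (simp only: module_hom.sum[OF Phi_hom] module_hom_sgnd[OF Phi_hom] fps_sum_nth sgnd_fps_nth)
  also have "\<dots> = (\<Sum>i<n. ?s i (fps_nth (G ((map A (map \<Phi> ?Y))[i := G (map \<Phi> ?X @ [map \<Phi> ?Y ! i])])) r))
      + (\<Sum>i<n. ?s i (br ((map \<alpha> ys)[i := obstruction \<phi> r (xs @ [ys ! i])])))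
      + (\<Sum>i<n. ?s i (obstruction \<phi> r ((map \<alpha> ys)[i := br (xs @ [ys ! i])])))"
    unfolding sum.distrib[symmetric] sgnd_add[symmetric] by (intro sum.cong refl) (simp only: R lessThan_iff)
  finally have "fps_nth (\<Phi> (F (map A ?X @ [F ?Y]))) r = \<dots>" .
  \<comment> \<open>This identity removes all terms free of the obstruction.\<close>
  moreover have "G (map A (map \<Phi> ?X) @ [G (map \<Phi> ?Y)]) =
      (\<Sum>i<n. ?s i (G ((map A (map \<Phi> ?Y))[i := G (map \<Phi> ?X @ [map \<Phi> ?Y ! i])])))"
    using xs(1) ys(1)
    by (intro null.br_hom_nambu homog_map[where \<phi> = \<Phi>, OF Phi_mem homog_const[OF xs(2)]]
        homog_map[where \<phi> = \<Phi>, OF Phi_mem homog_const[OF ys(2)]]) simp_all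
  then have "fps_nth (G (map A (map \<Phi> ?X) @ [G (map \<Phi> ?Y)])) r =
      (\<Sum>i<n. ?s i (fps_nth (G ((map A (map \<Phi> ?Y))[i := G (map \<Phi> ?X @ [map \<Phi> ?Y ! i])])) r))"
    by (simp only: fps_sum_nth sgnd_fps_nth)
  ultimately show ?thesis
    unfolding L by (simp only: delta2_homog_def) (simp add: algebra_simps del: map_map nth_map)
qed

lemma obstruction_cocycle: "obstruction \<phi> r \<in> cocycles2 scale gr n br \<alpha>"
  by (rule even_cocycleI[OF obstruction_cochain obstruction_even n_pos obstruction_delta2])

end

end

end


section \<open>Removing the obstruction\<close>

context series_superalgebra_deformation
begin

lemma fps_lin_series_cong:
  "(\<And>i. i \<le> m \<Longrightarrow> \<phi> i = \<phi>' i) \<Longrightarrow> fps_nth (fps_lin_series \<phi> X) m = fps_nth (fps_lin_series \<phi>' X) m"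
  by (simp add: fps_lin_series_nth)

text \<open>All exponents occurring in coefficient m are at most m. Hence changing \<phi> at index r
  leaves the coefficients below r untouched, and a limit of such changes can be read off at a finite
  stage.\<close>

lemma discrepancy_cong:
  assumes "\<And>i. i \<le> m \<Longrightarrow> \<phi> i = \<phi>' i"
  shows "fps_nth (discrepancy \<phi> Xs) m = fps_nth (discrepancy \<phi>' Xs) m"
proof -
  have "map2 fps_nth (map (fps_lin_series \<phi>) Xs) ks = map2 fps_nth (map (fps_lin_series \<phi>') Xs) ks"
    if "length ks = length Xs" "sum_list ks = m" for ks
  proof (rule nth_equalityI)
    fix i assume "i < length (map2 fps_nth (map (fps_lin_series \<phi>) Xs) ks)"
    then have i: "i < length ks" "i < length Xs" by auto
    then have "ks ! i \<le> m" using that member_le_sum_list[of "ks ! i" ks] by simp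
    then show "map2 fps_nth (map (fps_lin_series \<phi>) Xs) ks ! i = map2 fps_nth (map (fps_lin_series \<phi>') Xs) ks ! i"
      using i assms by (simp add: fps_lin_series_cong[of "ks ! i" \<phi> \<phi>'])
  qed simp
  then show ?thesis
    using fps_lin_series_cong[of m \<phi> \<phi>'] assms by (simp add: discrepancy_def null_series_nth)
qed

text \<open>In degree \<open>r\<close> the coefficient \<open>\<phi>\<^sub>r\<close> occurs in \<open>G (\<Phi> X)\<close> only in the terms
  where all other arguments contribute their constant coefficient.\<close>

lemma discrepancy_update:
  assumes adm: "admissible \<phi>" and \<psi>: "module_hom scale scale \<psi>" and r: "0 < r" and xs: "length xs = n"
  shows "fps_nth (discrepancy (\<phi>(r := \<lambda>x. \<phi> r x + \<psi> x)) (map fps_const xs)) r =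
    fps_nth (discrepancy \<phi> (map fps_const xs)) r + \<psi> (br xs) - (\<Sum>i<n. br (xs[i := \<psi> (xs ! i)]))"
proof -
  let ?\<phi>' = "\<phi>(r := \<lambda>x. \<phi> r x + \<psi> x)" and ?X = "map fps_const xs"
  let ?K = "{ks :: nat list. length ks = n \<and> sum_list ks = r}"
  \<comment> \<open>The exponent lists of total r that contain the entry r.\<close>
  let ?e = "\<lambda>i. (replicate n 0)[i := r]"
  note hom = phi_hom[OF adm]
  have hom': "module_hom scale scale (?\<phi>' i)" for i
    using hom self.module_hom_add[OF hom \<psi>] by simp
  have lin: "fps_nth (fps_lin_series ?\<phi>' (F ?X)) r = fps_nth (fps_lin_series \<phi> (F ?X)) r + \<psi> (br xs)"
  proof -
    have "fps_nth (fps_lin_series ?\<phi>' (F ?X)) r =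
        (\<Sum>i\<le>r. \<phi> i (fps_nth (F ?X) (r - i)) + (if i = r then \<psi> (fps_nth (F ?X) (r - i)) else 0))"
      unfolding fps_lin_series_nth by (intro sum.cong) auto
    also have "\<dots> = fps_nth (fps_lin_series \<phi> (F ?X)) r + \<psi> (fps_nth (F ?X) 0)"
      by (simp add: sum.distrib fps_lin_series_nth)
    finally show ?thesis using xs by (simp add: F_nth_0 o_def)
  qed
  \<comment> \<open>At constants, the series Phi has coefficients \<open>\<phi> k x\<close>, so
    coefficient r of G after Phi is the sum of these brackets over exponent lists of total
    r.\<close>
  define b where "b \<phi> ks = br (map2 (\<lambda>k x. \<phi> k x) ks xs)" for \<phi> :: "nat \<Rightarrow> 'v \<Rightarrow> 'v" and ks
  have G: "fps_nth (G (map (fps_lin_series \<phi>) ?X)) r = (\<Sum>ks\<in>?K. b \<phi> ks)"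
    if "\<And>i. module_hom scale scale (\<phi> i)" for \<phi>
    unfolding null_series_nth b_def using xs
    by (intro sum.cong) (auto simp: fps_lin_series_const[OF that] intro!: arg_cong[of _ _ br] nth_equalityI)
  have inj: "inj_on ?e {..<n}"
  proof (rule inj_onI)
    fix i j assume "i \<in> {..<n}" "j \<in> {..<n}" and eq: "?e i = ?e j"
    show "i = j"
    proof (rule ccontr)
      assume "i \<noteq> j"
      then have "?e i ! i = r" "?e j ! i = 0" using \<open>i \<in> {..<n}\<close> by simp_all
      with eq r show False by simp
    qed
  qed
  have "(\<Sum>ks\<in>?K. b ?\<phi>' ks - b \<phi> ks) = (\<Sum>ks\<in>?e ` {..<n}. b ?\<phi>' ks - b \<phi> ks)"
  proof (rule sum.mono_neutral_right)
    show "?e ` {..<n} \<subseteq> ?K"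
    proof
      fix ks assume "ks \<in> ?e ` {..<n}"
      then obtain i where "i < n" "ks = ?e i" by blast
      then show "ks \<in> ?K" using sum_list_update_nat[of i "replicate n 0" r] by (simp add: sum_list_replicate)
    qed
    show "\<forall>ks\<in>?K - ?e ` {..<n}. b ?\<phi>' ks - b \<phi> ks = 0"
    proof
      fix ks assume ks: "ks \<in> ?K - ?e ` {..<n}"
      \<comment> \<open>An entry r uses up the whole total, so all other entries would be 0 and the
        list would be \<open>?e i\<close>.\<close>
      have "ks ! i \<noteq> r" if i: "i < n" for i
      proof
        assume "ks ! i = r"
        then have "sum_list (ks[i := 0]) = 0"
          using ks i sum_list_update_nat[of i ks 0] by simp
        then have "ks[i := 0] = replicate n 0" using ks sum_list_zero_replicate[of "ks[i := 0]"] by simp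
        then have "ks = ?e i" using \<open>ks ! i = r\<close> by (metis list_update_id list_update_overwrite)
        then show False using ks i by blast
      qed
      then have "map2 (\<lambda>k x. ?\<phi>' k x) ks xs = map2 (\<lambda>k x. \<phi> k x) ks xs"
        using ks xs by (intro nth_equalityI) auto
      then have "b ?\<phi>' ks = b \<phi> ks" unfolding b_def by (rule arg_cong)
      then show "b ?\<phi>' ks - b \<phi> ks = 0" by (simp only: diff_self)
    qed
  qed (rule finite_exponents)
  also have "\<dots> = (\<Sum>i<n. b ?\<phi>' (?e i) - b \<phi> (?e i))"
    by (simp only: sum.reindex[OF inj] o_def)
  also have "\<dots> = (\<Sum>i<n. br (xs[i := \<psi> (xs ! i)]))"
  proof (intro sum.cong refl)
    fix i assume "i \<in> {..<n}"
    then have i: "i < n" by simp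
    \<comment> \<open>Away from slot i the exponent 0 applies \<open>\<chi> 0\<close>, the identity.
      This also holds for \<open>?\<phi>'\<close>, because r > 0 keeps index 0 unchanged.\<close>
    have "map2 (\<lambda>k x. \<chi> k x) (?e i) xs = xs[i := \<chi> r (xs ! i)]" if "\<chi> 0 = id" for \<chi> :: "nat \<Rightarrow> 'v \<Rightarrow> 'v"
      using that xs i by (intro nth_equalityI) (auto simp: nth_list_update)
    then have "b \<chi> (?e i) = br (xs[i := \<chi> r (xs ! i)])" if "\<chi> 0 = id" for \<chi>
      using that by (simp add: b_def)
    from this[of \<phi>] this[of ?\<phi>'] show "b ?\<phi>' (?e i) - b \<phi> (?e i) = br (xs[i := \<psi> (xs ! i)])"
      using phi_0[OF adm] r by (simp add: nlinear_add[OF nlinear_br xs i])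
  qed
  finally show ?thesis
    unfolding discrepancy_def fps_sub_nth lin G[OF hom] G[of ?\<phi>', OF hom']
    by (simp add: sum_subtractf algebra_simps del: fun_upd_apply)
qed

definition solved_below :: "nat \<Rightarrow> (nat \<Rightarrow> 'v \<Rightarrow> 'v) \<Rightarrow> bool" where
  "solved_below r \<phi> \<longleftrightarrow> (\<forall>m ds xs. m < r \<longrightarrow> length xs = n \<longrightarrow> homog gr ds xs \<longrightarrow>
     fps_nth (discrepancy \<phi> (map fps_const xs)) m = 0)"

lemma solve_next:
  assumes Z: "cocycles2 scale gr n br \<alpha> \<subseteq> coboundaries2 scale gr n br \<alpha>"
    and adm: "admissible \<phi>" and solved: "solved_below r \<phi>" and r: "0 < r"
  shows "\<exists>\<phi>'. (admissible \<phi>' \<and> solved_below (Suc r) \<phi>') \<and> (\<forall>i<r. \<phi>' i = \<phi> i)"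
proof -
  have below: "fps_nth (discrepancy \<phi> (map fps_const xs)) m = 0" if "m < r" "length xs = n" "homog gr ds xs" for m ds xs
    using solved that unfolding solved_below_def by blast
  have "obstruction \<phi> r \<in> cocycles2 scale gr n br \<alpha>"
    by (rule obstruction_cocycle[OF adm]) (rule below)
  then have "obstruction \<phi> r \<in> coboundaries2 scale gr n br \<alpha>" using Z by (rule rev_subsetD)
  then show ?thesis
  proof (rule even_coboundary)
    show "obstruction \<phi> r xs \<in> gr (sum_list ds)" if "length xs = n" "homog gr ds xs" for ds xs
      by (rule obstruction_even[OF adm _ that]) (rule below)
  next
    fix \<psi> assume \<psi>: "even_linear scale gr \<psi>" "\<psi> \<circ> \<alpha> = \<alpha> \<circ> \<psi>"
      and D: "\<And>ds xs. \<lbrakk>length xs = n; homog gr ds xs\<rbrakk> \<Longrightarrow>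
        obstruction \<phi> r xs = - \<psi> (br xs) + (\<Sum>i<n. br (xs[i := \<psi> (xs ! i)]))"
    let ?\<phi>' = "\<phi>(r := \<lambda>x. \<phi> r x + \<psi> x)"
    have "even_linear scale gr (\<lambda>x. \<phi> r x + \<psi> x)"
      using phi_even[OF adm, of r] \<psi>(1) by (auto simp: even_linear_def self.module_hom_add gr_add)
    moreover have "(\<lambda>x. \<phi> r x + \<psi> x) \<circ> \<alpha> = \<alpha> \<circ> (\<lambda>x. \<phi> r x + \<psi> x)"
      using \<psi>(2) phi_alpha[OF adm] by (auto simp: fun_eq_iff module_hom.add[OF alpha_hom])
    ultimately have "admissible ?\<phi>'"
      using adm r by (auto simp: admissible_def)
    moreover have "solved_below (Suc r) ?\<phi>'"
      unfolding solved_below_def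
    proof (intro allI impI)
      fix m ds xs assume m: "m < Suc r" and xs: "length xs = n" "homog gr ds xs"
      show "fps_nth (discrepancy ?\<phi>' (map fps_const xs)) m = 0"
      proof (cases "m = r")
        case True
        \<comment> \<open>By \<open>discrepancy_update\<close> adding \<psi> changes the coefficient
          by minus the coboundary of \<psi>, that is, by minus the obstruction.\<close>
        then show ?thesis
          using discrepancy_update[OF adm even_linear_hom[OF \<psi>(1)] r xs(1)] D[OF xs]
          by (simp add: obstruction_def)
      next
        case False
        then have "fps_nth (discrepancy ?\<phi>' (map fps_const xs)) m = fps_nth (discrepancy \<phi> (map fps_const xs)) m"
          using m by (intro discrepancy_cong) auto
        then show ?thesis using below[OF _ xs] False m by simp
      qed
    qed
    ultimately show ?thesis by (intro exI[of _ ?\<phi>']) auto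
  qed
qed

text \<open>The bounding cochains are not canonical, so the stages come from dependent choice. Each
  index is final after finitely many stages, so the diagonal of the stages is the required
  series.\<close>

lemma ex_trivialization:
  assumes "cocycles2 scale gr n br \<alpha> \<subseteq> coboundaries2 scale gr n br \<alpha>"
  obtains \<phi> where "admissible \<phi>" "\<And>Xs. length Xs = n \<Longrightarrow> discrepancy \<phi> Xs = 0"
proof -
  define \<iota> :: "nat \<Rightarrow> 'v \<Rightarrow> 'v" where "\<iota> i = (if i = 0 then id else (\<lambda>x. 0))" for i
  have "module_hom scale scale (\<iota> i)" for i
    unfolding \<iota>_def using self.module_hom_zero module_hom_id by simp
  then have "admissible \<iota>"
    by (auto simp: admissible_def even_linear_def \<iota>_def gr_zero fun_eq_iff module_hom.zero[OF alpha_hom])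
  \<comment> \<open>The identity series works at order 0, since F and G have the same constant
    term.\<close>
  moreover have "solved_below (Suc 0) \<iota>"
    by (auto simp: solved_below_def discrepancy_def fps_lin_series_nth G_nth_0 F_nth_0 \<iota>_def o_def)
  ultimately have start: "admissible \<iota> \<and> solved_below (Suc 0) \<iota>" by simp
  \<comment> \<open>Stage k is solved through order k; the next stage may differ only from index k +
    1 on, so index 0 is never touched.\<close>
  have "\<exists>g. \<forall>k. (admissible (g k) \<and> solved_below (Suc k) (g k)) \<and> (\<forall>i<Suc k. g (Suc k) i = g k i)"
    using start solve_next[OF assms]
    by (intro dependent_nat_choice[where P = "\<lambda>k \<phi>. admissible \<phi> \<and> solved_below (Suc k) \<phi>" and
          Q = "\<lambda>k \<phi> \<phi>'. \<forall>i<Suc k. \<phi>' i = \<phi> i"]) blast+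
  then obtain g where adm: "\<And>k. admissible (g k)" and solved: "\<And>k. solved_below (Suc k) (g k)"
    and agree: "\<And>k i. i \<le> k \<Longrightarrow> g (Suc k) i = g k i" by (auto simp: less_Suc_eq_le)
  define \<phi> where "\<phi> i = g i i" for i
  have g: "g k i = \<phi> i" if "i \<le> k" for k i
    using that by (induction k rule: dec_induct) (simp_all add: \<phi>_def agree)
  have phi: "admissible \<phi>"
    using adm unfolding admissible_def \<phi>_def by blast
  have const: "fps_nth (discrepancy \<phi> (map fps_const xs)) m = 0" if "length xs = n" "homog gr ds xs" for m ds xs
  proof -
    have "fps_nth (discrepancy \<phi> (map fps_const xs)) m = fps_nth (discrepancy (g m) (map fps_const xs)) m"
      by (rule discrepancy_cong) (simp add: g)
    then show ?thesis using solved[of m] that unfolding solved_below_def by simp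
  qed
  \<comment> \<open>Passage from homogeneous constants to arbitrary series, with bound
    \<open>Suc m\<close> to reach coefficient m itself.\<close>
  have "fps_nth (discrepancy \<phi> Xs) m = 0" if "length Xs = n" for Xs m
    by (rule discrepancy_below[OF phi _ that lessI]) (rule const)
  then have "discrepancy \<phi> Xs = 0" if "length Xs = n" for Xs
    using that by (intro fps_ext) simp
  with phi that show thesis by blast
qed

end

theorem theorem3p6:
  fixes scale :: "'k::field \<Rightarrow> 'v::ab_group_add \<Rightarrow> 'v"
    and gr :: "bit \<Rightarrow> 'v set" and n :: nat
    and br :: "'v list \<Rightarrow> 'v" and \<alpha> :: "'v \<Rightarrow> 'v"
  assumes "n \<ge> 2"
    and "hom_nambu_lie_superalgebra scale gr n br \<alpha>"
    and "cohomology2_trivial scale gr n br \<alpha>"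
  shows "analytically_rigid scale gr n br \<alpha>"
  unfolding analytically_rigid_def
proof (intro allI impI)
  fix f assume f: "deformation scale gr n br \<alpha> f"
  interpret hom_nambu_lie_superalgebra scale gr n br \<alpha> by fact
  interpret deformed: hom_nambu_lie_superalgebra "fps_scale scale" "fps_grading gr" n
    "fps_nlin_series f" "fps_extend \<alpha>"
    using f by (simp add: deformation_def)
  \<comment> \<open>The graded module of series is supplied by the interpretation of the deformed
    bracket just made.\<close>
  interpret series_superalgebra_deformation scale gr n br \<alpha> "fps_nlin_series f"
    by unfold_locales (use assms(1) f in \<open>auto simp: deformation_def fps_nlin_series_nth_0\<close>)
  obtain \<phi> where "admissible \<phi>" "\<And>Xs. length Xs = n \<Longrightarrow> discrepancy \<phi> Xs = 0"
    using ex_trivialization[OF cocycles2_subset_coboundaries2[OF assms(3)]] by blast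
  \<comment> \<open>A vanishing discrepancy is the intertwining equation, and bijectivity follows
    from \<open>\<phi> 0 = id\<close>.\<close>
  then show "equivalent_deformations scale gr n \<alpha> f (null_deformation br)"
    unfolding equivalent_deformations_def admissible_def discrepancy_def
    by (intro exI[of _ \<phi>]) (auto intro: bij_fps_lin_series)
qed

end
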